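(* Let $\mathbf{I} = (\mathscr{S}ig, \mathsf{Fm}, \mathsf{Mod}, \models)$ be a local institution, let $\Sigma$ be a signature of $\mathbf{I}$, let $M$ be a $\Sigma$-model (also called a $\Sigma$-structure), i.e. an object of $\mathsf{Mod}(\Sigma)$, and let $\phi \in \mathsf{Fm}(\Sigma)$ be a $\Sigma$-formula. If $M \models_{\Sigma} \phi$, then $H^{0}(\mathsf{Mod}_{\Sigma}[\phi]/M) \cong \mathbb{Z}$ and $H^{n}(\mathsf{Mod}_{\Sigma}[\phi]/M) = 0$ for every integer $n \neq 0$. In particular, if $\Gamma$ is a set of $\Sigma$-formulas and $H^{n}(\mathsf{Mod}_{\Sigma}[\phi]/M) \neq 0$ for some formula $\phi \in \Gamma$ and some integer $n \neq 0$, then $M$ is not a model of $\Gamma$, i.e. it is not the case that $M \models_{\Sigma} \psi$ for all $\psi \in \Gamma$.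
   Context: Universes. Fix two universes $\mathsf{U} \in \mathsf{V}$ with $\omega \in \mathsf{U}$. A $\mathsf{U}$-set is an element of $\mathsf{U}$; a $\mathsf{U}$-category is a category whose set of objects is a subset of $\mathsf{U}$ and all of whose Hom-sets are elements of $\mathsf{U}$. "Small" means $\mathsf{V}$-small (sets of objects and of arrows are elements of $\mathsf{V}$); every $\mathsf{U}$-category is small in this sense. Local institution. A local institution $\mathbf{I} = (\mathscr{S}ig, \mathsf{Fm}, \mathsf{Mod}, \models)$ consists of: a small category $\mathscr{S}ig$ (of signatures); a functor $\mathsf{Fm}$ from $\mathscr{S}ig$ to the category of $\mathsf{U}$-sets (elements of $\mathsf{Fm}(\Sigma)$ are called $\Sigma$-formulas; write $\sigma_{\sharp} = \mathsf{Fm}(\sigma)$); a functor $\mathsf{Mod}$ from $\mathscr{S}ig^{op}$ to the category of $\mathsf{U}$-categories (objects of $\mathsf{Mod}(\Sigma)$ are called $\Sigma$-models or $\Sigma$-structures; write $\sigma^{\sharp} = \mathsf{Mod}(\sigma)$); and for each signature $\Sigma$ a relation $\models_{\Sigma} \subseteq \mathrm{Ob}(\mathsf{Mod}(\Sigma)) \times \mathsf{Fm}(\Sigma)$; such that (I1) for every $\sigma : \Sigma \to \Sigma'$, every $\Sigma'$-model $M'$ and every $\Sigma$-formula $\varphi$, $M' \models_{\Sigma'} \sigma_{\sharp}(\varphi)$ iff $\sigma^{\sharp}(M') \models_{\Sigma} \varphi$; (I2) if $M, M'$ are isomorphic $\Sigma$-models, then $M \models_{\Sigma} \varphi$ iff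 $M' \models_{\Sigma} \varphi$ for every $\Sigma$-formula $\varphi$. Categories of models. $\mathsf{Mod}_{\Sigma}[\phi]$ denotes the full subcategory of $\mathsf{Mod}(\Sigma)$ whose objects are the $\Sigma$-models $N$ with $N \models_{\Sigma} \phi$. For an arbitrary $\Sigma$-model $M$, the category $\mathsf{Mod}_{\Sigma}[\phi]/M$ has as objects the pairs $(I,p)$ with $I$ an object of $\mathsf{Mod}_{\Sigma}[\phi]$ and $p : I \to M$ an arrow of $\mathsf{Mod}(\Sigma)$; an arrow $(I,p) \to (J,q)$ is an arrow $\alpha : I \to J$ with $q \circ \alpha = p$. Cohomology of a small category. For a small category $A$, let $\mathbf{D}(A)$ be the localization, at the objectwise quasi-isomorphisms, of the category of presheaves on $A$ with values in cochain complexes of abelian groups. Let $e$ be the category with one object and only its identity arrow, and $p_A : A \to e$ the unique functor. Composition with $p_A$ induces $(p_A)^{\ast} : \mathbf{D}(e) \to \mathbf{D}(A)$, which has a right adjoint $\mathsf{R}(p_A)_{\ast} : \mathbf{D}(A) \to \mathbf{D}(e)$, where $\mathbf{D}(e)$ is the derived category of abelian groups. The integer cohomology groups of $A$ are $H^{n}(A) = H^{n}(\mathsf{R}(p_A)_{\ast}(p_A)^{\ast}\mathbb{Z})$ for $n \in \mathbb{Z}$, where $\mathbb{Z}$ is regarded as a complex concentrated in degree $0$ and $H^n(C^\bullet) = \ker(d^n)/\mathrm{im}(d^{n-1})$ for a complex with differentials $d^n : C^n \to C^{n+1}$. *)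

theory Defs
  imports "HOL-Algebra.Elementary_Groups"
begin

section \<open>Universes\<close>

text \<open>
  A model of set theory is a type \<open>'z\<close> with a membership relation \<open>mem\<close>.  Separation and the
  union axiom of a universe are stated for arbitrary HOL sets and HOL functions on \<open>'z\<close>, so
  they are second order and a universe here is a full Grothendieck universe.
\<close>

definition elts :: "('z \<Rightarrow> 'z \<Rightarrow> bool) \<Rightarrow> 'z \<Rightarrow> 'z set" where
  "elts mem x = {y. mem y x}"

definition sets_in :: "('z \<Rightarrow> 'z \<Rightarrow> bool) \<Rightarrow> 'z \<Rightarrow> 'z set set" where
  "sets_in mem u = elts mem ` elts mem u"

locale set_theory =
  fixes mem :: "'z \<Rightarrow> 'z \<Rightarrow> bool"
  assumes extensionality: "\<And>x y. elts mem x = elts mem y \<Longrightarrow> x = y"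
    and foundation: "wf {(x, y). mem x y}"
    and separation: "\<And>x S. S \<subseteq> elts mem x \<Longrightarrow> \<exists>y. elts mem y = S"

definition universe :: "('z \<Rightarrow> 'z \<Rightarrow> bool) \<Rightarrow> 'z \<Rightarrow> bool" where
  "universe mem u \<longleftrightarrow>
     (\<forall>x y. mem x u \<and> mem y x \<longrightarrow> mem y u) \<and>
     (\<forall>x y. mem x u \<and> mem y u \<longrightarrow> (\<exists>z. mem z u \<and> elts mem z = {x, y})) \<and>
     (\<forall>x. mem x u \<longrightarrow> (\<exists>z. mem z u \<and> elts mem z = {y. elts mem y \<subseteq> elts mem x})) \<and>
     (\<forall>x f. mem x u \<and> (\<forall>y. mem y x \<longrightarrow> mem (f y) u) \<longrightarrow>
        (\<exists>z. mem z u \<and> elts mem z = (\<Union>y\<in>elts mem x. elts mem (f y))))"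

inductive von_neumann_nat :: "('z \<Rightarrow> 'z \<Rightarrow> bool) \<Rightarrow> 'z \<Rightarrow> bool" for mem where
  zero: "elts mem x = {} \<Longrightarrow> von_neumann_nat mem x"
| succ: "von_neumann_nat mem x \<Longrightarrow> elts mem y = insert x (elts mem x) \<Longrightarrow> von_neumann_nat mem y"

definition is_omega :: "('z \<Rightarrow> 'z \<Rightarrow> bool) \<Rightarrow> 'z \<Rightarrow> bool" where
  "is_omega mem w \<longleftrightarrow> elts mem w = {x. von_neumann_nat mem x}"

locale two_universes = set_theory mem
  for mem :: "'z \<Rightarrow> 'z \<Rightarrow> bool" +
  fixes U V :: 'z
  assumes universe_U: "universe mem U"
    and universe_V: "universe mem V"
    and U_in_V: "mem U V"
    and omega_in_U: "\<exists>w. is_omega mem w \<and> mem w U"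


section \<open>Categories and functors\<close>

record ('o, 'a) category =
  Obj :: "'o set"
  Arr :: "'a set"
  Dom :: "'a \<Rightarrow> 'o"
  Cod :: "'a \<Rightarrow> 'o"
  Ident :: "'o \<Rightarrow> 'a"
  Comp :: "'a \<Rightarrow> 'a \<Rightarrow> 'a"  \<comment> \<open>\<open>Comp C g f\<close> is \<open>g\<close> after \<open>f\<close>\<close>

definition Homs :: "('o, 'a) category \<Rightarrow> 'o \<Rightarrow> 'o \<Rightarrow> 'a set" where
  "Homs C a b = {f \<in> Arr C. Dom C f = a \<and> Cod C f = b}"

locale category =
  fixes C :: "('o, 'a) category"
  assumes dom_cod: "\<And>f. f \<in> Arr C \<Longrightarrow> Dom C f \<in> Obj C \<and> Cod C f \<in> Obj C"
    and ident: "\<And>a. a \<in> Obj C \<Longrightarrow> Ident C a \<in> Homs C a a"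
    and comp: "\<And>a b c f g. f \<in> Homs C a b \<Longrightarrow> g \<in> Homs C b c \<Longrightarrow> Comp C g f \<in> Homs C a c"
    and ident_left: "\<And>a b f. f \<in> Homs C a b \<Longrightarrow> Comp C (Ident C b) f = f"
    and ident_right: "\<And>a b f. f \<in> Homs C a b \<Longrightarrow> Comp C f (Ident C a) = f"
    and assoc: "\<And>a b c d f g h. f \<in> Homs C a b \<Longrightarrow> g \<in> Homs C b c \<Longrightarrow> h \<in> Homs C c d \<Longrightarrow>
      Comp C h (Comp C g f) = Comp C (Comp C h g) f"

definition isomorphic :: "('o, 'a) category \<Rightarrow> 'o \<Rightarrow> 'o \<Rightarrow> bool" where
  "isomorphic C a b \<longleftrightarrow>
     (\<exists>f\<in>Homs C a b. \<exists>g\<in>Homs C b a. Comp C g f = Ident C a \<and> Comp C f g = Ident C b)"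

definition opposite :: "('o, 'a) category \<Rightarrow> ('o, 'a) category" where
  "opposite C = C\<lparr>Dom := Cod C, Cod := Dom C, Comp := (\<lambda>g f. Comp C f g)\<rparr>"

definition full_subcategory :: "('o, 'a) category \<Rightarrow> ('o \<Rightarrow> bool) \<Rightarrow> ('o, 'a) category" where
  "full_subcategory C P =
     C\<lparr>Obj := {a \<in> Obj C. P a}, Arr := {f \<in> Arr C. P (Dom C f) \<and> P (Cod C f)}\<rparr>"

text \<open>For a subcategory \<open>S\<close> of \<open>C\<close> and an object \<open>m\<close> of \<open>C\<close> (not necessarily of \<open>S\<close>), the category
  \<open>S/m\<close>; its arrows carry their source and target.\<close>

definition slice ::
    "('o, 'a) category \<Rightarrow> ('o, 'a) category \<Rightarrow> 'o
     \<Rightarrow> ('o \<times> 'a, ('o \<times> 'a) \<times> 'a \<times> ('o \<times> 'a)) category" where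
  "slice C S m =
     \<lparr>Obj = {(i, p). i \<in> Obj S \<and> p \<in> Homs C i m},
      Arr = {((i, p), \<alpha>, (j, q)) | i p \<alpha> j q.
               i \<in> Obj S \<and> p \<in> Homs C i m \<and> j \<in> Obj S \<and> q \<in> Homs C j m \<and>
               \<alpha> \<in> Homs S i j \<and> Comp C q \<alpha> = p},
      Dom = (\<lambda>(x, \<alpha>, y). x),
      Cod = (\<lambda>(x, \<alpha>, y). y),
      Ident = (\<lambda>(i, p). ((i, p), Ident S i, (i, p))),
      Comp = (\<lambda>(y', \<beta>, z) (x, \<alpha>, y). (x, Comp S \<beta> \<alpha>, z))\<rparr>"

definition terminal_category :: "(unit, unit) category" where
  "terminal_category =
     \<lparr>Obj = UNIV, Arr = UNIV, Dom = (\<lambda>_. ()), Cod = (\<lambda>_. ()), Ident = (\<lambda>_. ()), Comp = (\<lambda>_ _. ())\<rparr>"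

record ('o, 'a, 'p, 'b) cat_functor =
  ob :: "'o \<Rightarrow> 'p"
  ar :: "'a \<Rightarrow> 'b"

locale cat_functor = src: category C + tgt: category D
  for C :: "('o, 'a) category" and D :: "('p, 'b) category"
    and F :: "('o, 'a, 'p, 'b) cat_functor" +
  assumes ob: "\<And>a. a \<in> Obj C \<Longrightarrow> ob F a \<in> Obj D"
    and ar: "\<And>a b f. f \<in> Homs C a b \<Longrightarrow> ar F f \<in> Homs D (ob F a) (ob F b)"
    and ar_ident: "\<And>a. a \<in> Obj C \<Longrightarrow> ar F (Ident C a) = Ident D (ob F a)"
    and ar_comp: "\<And>a b c f g. f \<in> Homs C a b \<Longrightarrow> g \<in> Homs C b c \<Longrightarrow>
      ar F (Comp C g f) = Comp D (ar F g) (ar F f)"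

definition to_terminal :: "('o, 'a, unit, unit) cat_functor" where
  "to_terminal = \<lparr>ob = (\<lambda>_. ()), ar = (\<lambda>_. ())\<rparr>"

definition right_adjoint ::
    "('o, 'a) category \<Rightarrow> ('p, 'b) category \<Rightarrow> ('o, 'a, 'p, 'b) cat_functor
     \<Rightarrow> ('p, 'b, 'o, 'a) cat_functor \<Rightarrow> bool" where
  "right_adjoint C D F G \<longleftrightarrow>
     cat_functor C D F \<and> cat_functor D C G \<and>
     (\<exists>\<Phi>. (\<forall>x\<in>Obj C. \<forall>y\<in>Obj D.
              bij_betw (\<Phi> x y) (Homs D (ob F x) y) (Homs C x (ob G y))) \<and>
          (\<forall>x\<in>Obj C. \<forall>x'\<in>Obj C. \<forall>y\<in>Obj D. \<forall>y'\<in>Obj D.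
             \<forall>f\<in>Homs C x' x. \<forall>h\<in>Homs D (ob F x) y. \<forall>g\<in>Homs D y y'.
               \<Phi> x' y' (Comp D g (Comp D h (ar F f)))
                 = Comp C (ar G g) (Comp C (\<Phi> x y h) f)))"

text \<open>In categories whose arrows are functions, families of functions or functors, these are
  taken extensional, so that equality of arrows is the intended one.\<close>

definition functor_category ::
    "('o, 'a) category \<Rightarrow> ('p, 'b) category
     \<Rightarrow> (('o, 'a, 'p, 'b) cat_functor,
         ('o, 'a, 'p, 'b) cat_functor \<times> ('o \<Rightarrow> 'b) \<times> ('o, 'a, 'p, 'b) cat_functor) category" where
  "functor_category C D =
     \<lparr>Obj = {F. cat_functor C D F},
      Arr = {(F, \<eta>, G). cat_functor C D F \<and> cat_functor C D G \<and> \<eta> \<in> extensional (Obj C) \<and>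
               (\<forall>a\<in>Obj C. \<eta> a \<in> Homs D (ob F a) (ob G a)) \<and>
               (\<forall>a\<in>Obj C. \<forall>b\<in>Obj C. \<forall>f\<in>Homs C a b.
                  Comp D (\<eta> b) (ar F f) = Comp D (ar G f) (\<eta> a))},
      Dom = (\<lambda>(F, \<eta>, G). F),
      Cod = (\<lambda>(F, \<eta>, G). G),
      Ident = (\<lambda>F. (F, \<lambda>a\<in>Obj C. Ident D (ob F a), F)),
      Comp = (\<lambda>(G', \<theta>, H) (F, \<eta>, G). (F, \<lambda>a\<in>Obj C. Comp D (\<theta> a) (\<eta> a), H))\<rparr>"


section \<open>Local institutions\<close>

text \<open>The category of sets belonging to \<open>\<U>\<close>, each set given by its extension.\<close>

definition set_category :: "'z set set \<Rightarrow> ('z set, 'z set \<times> ('z \<Rightarrow> 'z) \<times> 'z set) category" where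
  "set_category \<U> =
     \<lparr>Obj = \<U>,
      Arr = {(X, f, Y). X \<in> \<U> \<and> Y \<in> \<U> \<and> f \<in> X \<rightarrow>\<^sub>E Y},
      Dom = (\<lambda>(X, f, Y). X),
      Cod = (\<lambda>(X, f, Y). Y),
      Ident = (\<lambda>X. (X, \<lambda>x\<in>X. x, X)),
      Comp = (\<lambda>(Y', g, Z) (X, f, Y). (X, compose X g f, Z))\<rparr>"

definition universe_category :: "('z \<Rightarrow> 'z \<Rightarrow> bool) \<Rightarrow> 'z \<Rightarrow> ('z, 'z) category \<Rightarrow> bool" where
  "universe_category mem u C \<longleftrightarrow>
     category C \<and> Obj C \<subseteq> elts mem u \<and>
     (\<forall>a\<in>Obj C. \<forall>b\<in>Obj C. Homs C a b \<in> sets_in mem u)"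

definition small_category :: "('z \<Rightarrow> 'z \<Rightarrow> bool) \<Rightarrow> 'z \<Rightarrow> ('z, 'z) category \<Rightarrow> bool" where
  "small_category mem v C \<longleftrightarrow> category C \<and> Obj C \<in> sets_in mem v \<and> Arr C \<in> sets_in mem v"

definition category_category ::
    "('z \<Rightarrow> 'z \<Rightarrow> bool) \<Rightarrow> 'z
     \<Rightarrow> (('z, 'z) category,
         ('z, 'z) category \<times> ('z, 'z, 'z, 'z) cat_functor \<times> ('z, 'z) category) category" where
  "category_category mem u =
     \<lparr>Obj = {C. universe_category mem u C},
      Arr = {(C, F, D). universe_category mem u C \<and> universe_category mem u D \<and>
               cat_functor C D F \<and> ob F \<in> extensional (Obj C) \<and> ar F \<in> extensional (Arr C)},
      Dom = (\<lambda>(C, F, D). C),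
      Cod = (\<lambda>(C, F, D). D),
      Ident = (\<lambda>C. (C, \<lparr>ob = (\<lambda>a\<in>Obj C. a), ar = (\<lambda>f\<in>Arr C. f)\<rparr>, C)),
      Comp = (\<lambda>(D', G, E) (C, F, D).
                (C, \<lparr>ob = compose (Obj C) (ob G) (ob F), ar = compose (Arr C) (ar G) (ar F)\<rparr>, E))\<rparr>"

record 'z institution =
  Sig :: "('z, 'z) category"
  Fm :: "('z, 'z, 'z set, 'z set \<times> ('z \<Rightarrow> 'z) \<times> 'z set) cat_functor"
  Mdl :: "('z, 'z, ('z, 'z) category,
           ('z, 'z) category \<times> ('z, 'z, 'z, 'z) cat_functor \<times> ('z, 'z) category) cat_functor"
  Sat :: "'z \<Rightarrow> ('z \<times> 'z) set"

abbreviation formulas :: "'z institution \<Rightarrow> 'z \<Rightarrow> 'z set" where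
  "formulas I S \<equiv> ob (Fm I) S"

abbreviation models :: "'z institution \<Rightarrow> 'z \<Rightarrow> ('z, 'z) category" where
  "models I S \<equiv> ob (Mdl I) S"

abbreviation satisfies :: "'z institution \<Rightarrow> 'z \<Rightarrow> 'z \<Rightarrow> 'z \<Rightarrow> bool" where
  "satisfies I S M \<phi> \<equiv> (M, \<phi>) \<in> Sat I S"

definition translate :: "'z institution \<Rightarrow> 'z \<Rightarrow> 'z \<Rightarrow> 'z" where
  "translate I \<sigma> = fst (snd (ar (Fm I) \<sigma>))"

definition reduct :: "'z institution \<Rightarrow> 'z \<Rightarrow> ('z, 'z, 'z, 'z) cat_functor" where
  "reduct I \<sigma> = fst (snd (ar (Mdl I) \<sigma>))"

locale local_institution =
  fixes mem :: "'z \<Rightarrow> 'z \<Rightarrow> bool" and U V :: 'z and I :: "'z institution"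
  assumes Sig_small: "small_category mem V (Sig I)"
    and Fm_functor: "cat_functor (Sig I) (set_category (sets_in mem U)) (Fm I)"
    and Mdl_functor: "cat_functor (opposite (Sig I)) (category_category mem U) (Mdl I)"
    and Sat_subset: "\<And>S. S \<in> Obj (Sig I) \<Longrightarrow> Sat I S \<subseteq> Obj (models I S) \<times> formulas I S"
    and I1: "\<And>S S' \<sigma> M' \<phi>. S \<in> Obj (Sig I) \<Longrightarrow> S' \<in> Obj (Sig I) \<Longrightarrow> \<sigma> \<in> Homs (Sig I) S S' \<Longrightarrow>
      M' \<in> Obj (models I S') \<Longrightarrow> \<phi> \<in> formulas I S \<Longrightarrow>
      satisfies I S' M' (translate I \<sigma> \<phi>) \<longleftrightarrow> satisfies I S (ob (reduct I \<sigma>) M') \<phi>"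
    and I2: "\<And>S M M' \<phi>. S \<in> Obj (Sig I) \<Longrightarrow> M \<in> Obj (models I S) \<Longrightarrow> M' \<in> Obj (models I S) \<Longrightarrow>
      isomorphic (models I S) M M' \<Longrightarrow> \<phi> \<in> formulas I S \<Longrightarrow>
      satisfies I S M \<phi> \<longleftrightarrow> satisfies I S M' \<phi>"

definition models_of :: "'z institution \<Rightarrow> 'z \<Rightarrow> 'z \<Rightarrow> ('z, 'z) category" where
  "models_of I S \<phi> = full_subcategory (models I S) (\<lambda>N. satisfies I S N \<phi>)"

definition models_over ::
    "'z institution \<Rightarrow> 'z \<Rightarrow> 'z \<Rightarrow> 'z \<Rightarrow> ('z \<times> 'z, ('z \<times> 'z) \<times> 'z \<times> ('z \<times> 'z)) category" where
  "models_over I S \<phi> M = slice (models I S) (models_of I S \<phi>) M"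


section \<open>Cochain complexes of abelian groups\<close>

text \<open>Abelian groups are written multiplicatively, as \<open>comm_group\<close>s whose carriers belong
  to a given collection \<open>\<V>\<close> of sets.\<close>

record 'z cochain_complex =
  Grp :: "int \<Rightarrow> 'z monoid"
  Diff :: "int \<Rightarrow> 'z \<Rightarrow> 'z"

type_synonym 'z cochain_arrow = "'z cochain_complex \<times> (int \<Rightarrow> 'z \<Rightarrow> 'z) \<times> 'z cochain_complex"

definition cochain_complex :: "'z set set \<Rightarrow> 'z cochain_complex \<Rightarrow> bool" where
  "cochain_complex \<V> X \<longleftrightarrow>
     (\<forall>n. comm_group (Grp X n) \<and> carrier (Grp X n) \<in> \<V> \<and>
          Diff X n \<in> hom (Grp X n) (Grp X (n + 1)) \<and>
          (\<forall>x\<in>carrier (Grp X n). Diff X (n + 1) (Diff X n x) = \<one>\<^bsub>Grp X (n + 1 + 1)\<^esub>))"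

definition cochain_map ::
    "'z cochain_complex \<Rightarrow> 'z cochain_complex \<Rightarrow> (int \<Rightarrow> 'z \<Rightarrow> 'z) \<Rightarrow> bool" where
  "cochain_map X Y f \<longleftrightarrow>
     (\<forall>n. f n \<in> hom (Grp X n) (Grp Y n) \<and> f n \<in> extensional (carrier (Grp X n)) \<and>
          (\<forall>x\<in>carrier (Grp X n). f (n + 1) (Diff X n x) = Diff Y n (f n x)))"

definition complex_category :: "'z set set \<Rightarrow> ('z cochain_complex, 'z cochain_arrow) category" where
  "complex_category \<V> =
     \<lparr>Obj = {X. cochain_complex \<V> X},
      Arr = {(X, f, Y). cochain_complex \<V> X \<and> cochain_complex \<V> Y \<and> cochain_map X Y f},
      Dom = (\<lambda>(X, f, Y). X),
      Cod = (\<lambda>(X, f, Y). Y),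
      Ident = (\<lambda>X. (X, \<lambda>n. \<lambda>x\<in>carrier (Grp X n). x, X)),
      Comp = (\<lambda>(Y', g, Z) (X, f, Y). (X, \<lambda>n. compose (carrier (Grp X n)) (g n) (f n), Z))\<rparr>"

definition coboundaries :: "'z cochain_complex \<Rightarrow> int \<Rightarrow> 'z set" where
  "coboundaries X n = Diff X (n - 1) ` carrier (Grp X (n - 1))"

definition complex_cohomology :: "'z cochain_complex \<Rightarrow> int \<Rightarrow> 'z set monoid" where
  "complex_cohomology X n =
     (Grp X n)\<lparr>carrier := kernel (Grp X n) (Grp X (n + 1)) (Diff X n)\<rparr> Mod coboundaries X n"

definition cohomology_map :: "'z cochain_arrow \<Rightarrow> int \<Rightarrow> 'z set \<Rightarrow> 'z set" where
  "cohomology_map = (\<lambda>(X, f, Y) n c. \<Union>x\<in>c. coboundaries Y n #>\<^bsub>Grp Y n\<^esub> f n x)"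

definition quasi_isomorphisms :: "'z set set \<Rightarrow> 'z cochain_arrow set" where
  "quasi_isomorphisms \<V> =
     {(X, f, Y) \<in> Arr (complex_category \<V>).
        \<forall>n. cohomology_map (X, f, Y) n \<in> iso (complex_cohomology X n) (complex_cohomology Y n)}"

definition integers_copy :: "'z set set \<Rightarrow> 'z monoid" where
  "integers_copy \<V> = (SOME G. comm_group G \<and> carrier G \<in> \<V> \<and> G \<cong> integer_group)"

definition integers_complex :: "'z set set \<Rightarrow> 'z cochain_complex" where
  "integers_complex \<V> =
     (let G = integers_copy \<V>
      in \<lparr>Grp = (\<lambda>n. if n = 0 then G else G\<lparr>carrier := {\<one>\<^bsub>G\<^esub>}\<rparr>), Diff = (\<lambda>n x. \<one>\<^bsub>G\<^esub>)\<rparr>)"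


section \<open>Localization of categories\<close>

text \<open>
  The localization of \<open>C\<close> at a set \<open>W\<close> of arrows, following Gabriel and Zisman: the objects are those
  of \<open>C\<close> and the arrows are the zigzags of arrows of \<open>C\<close> and formal inverses of arrows of \<open>W\<close>,
  modulo the congruence generated by the identities and compositions of \<open>C\<close> and by the
  cancellation of \<open>w\<close> against its formal inverse.  Zigzags are lists in diagrammatic order.
\<close>

datatype 'a zigzag_step = Fwd 'a | Inv 'a

fun step_from :: "('o, 'a) category \<Rightarrow> 'a zigzag_step \<Rightarrow> 'o" where
  "step_from C (Fwd f) = Dom C f"
| "step_from C (Inv w) = Cod C w"

fun step_to :: "('o, 'a) category \<Rightarrow> 'a zigzag_step \<Rightarrow> 'o" where
  "step_to C (Fwd f) = Cod C f"
| "step_to C (Inv w) = Dom C w"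

fun step_ok :: "('o, 'a) category \<Rightarrow> 'a set \<Rightarrow> 'a zigzag_step \<Rightarrow> bool" where
  "step_ok C W (Fwd f) \<longleftrightarrow> f \<in> Arr C"
| "step_ok C W (Inv w) \<longleftrightarrow> w \<in> W"

fun zigzag :: "('o, 'a) category \<Rightarrow> 'a set \<Rightarrow> 'o \<Rightarrow> 'a zigzag_step list \<Rightarrow> 'o \<Rightarrow> bool" where
  "zigzag C W a [] b \<longleftrightarrow> a \<in> Obj C \<and> a = b"
| "zigzag C W a (s # p) b \<longleftrightarrow> step_ok C W s \<and> step_from C s = a \<and> zigzag C W (step_to C s) p b"

inductive zigzag_eq ::
    "('o, 'a) category \<Rightarrow> 'a set \<Rightarrow> 'o \<Rightarrow> 'o \<Rightarrow> 'a zigzag_step list \<Rightarrow> 'a zigzag_step list \<Rightarrow> bool"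
  for C W where
  refl: "zigzag C W a p b \<Longrightarrow> zigzag_eq C W a b p p"
| sym: "zigzag_eq C W a b p q \<Longrightarrow> zigzag_eq C W a b q p"
| trans: "zigzag_eq C W a b p q \<Longrightarrow> zigzag_eq C W a b q r \<Longrightarrow> zigzag_eq C W a b p r"
| congruence: "zigzag C W c u a \<Longrightarrow> zigzag_eq C W a b p q \<Longrightarrow> zigzag C W b v d \<Longrightarrow>
    zigzag_eq C W c d (u @ p @ v) (u @ q @ v)"
| ident: "a \<in> Obj C \<Longrightarrow> zigzag_eq C W a a [Fwd (Ident C a)] []"
| comp: "f \<in> Homs C a b \<Longrightarrow> g \<in> Homs C b c \<Longrightarrow>
    zigzag_eq C W a c [Fwd f, Fwd g] [Fwd (Comp C g f)]"
| cancel_left: "w \<in> W \<Longrightarrow> w \<in> Homs C a b \<Longrightarrow> zigzag_eq C W a a [Fwd w, Inv w] []"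
| cancel_right: "w \<in> W \<Longrightarrow> w \<in> Homs C a b \<Longrightarrow> zigzag_eq C W b b [Inv w, Fwd w] []"

type_synonym ('o, 'a) loc_arrow = "'o \<times> 'a zigzag_step list set \<times> 'o"

definition zigzag_class ::
    "('o, 'a) category \<Rightarrow> 'a set \<Rightarrow> 'o \<Rightarrow> 'o \<Rightarrow> 'a zigzag_step list \<Rightarrow> 'a zigzag_step list set" where
  "zigzag_class C W a b p = {q. zigzag_eq C W a b p q}"

definition localization ::
    "('o, 'a) category \<Rightarrow> 'a set \<Rightarrow> ('o, ('o, 'a) loc_arrow) category" where
  "localization C W =
     \<lparr>Obj = Obj C,
      Arr = {(a, zigzag_class C W a b p, b) | a b p. zigzag C W a p b},
      Dom = (\<lambda>(a, P, b). a),
      Cod = (\<lambda>(a, P, b). b),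
      Ident = (\<lambda>a. (a, zigzag_class C W a a [], a)),
      Comp = (\<lambda>(b', Q, c) (a, P, b). (a, \<Union>p\<in>P. \<Union>q\<in>Q. zigzag_class C W a c (p @ q), c))\<rparr>"

text \<open>The functor from a localization of \<open>C\<close> to the localization of \<open>D\<close> at \<open>W'\<close> induced by a functor
  \<open>F\<close> from \<open>C\<close> to \<open>D\<close> that maps the inverted arrows into \<open>W'\<close>.\<close>

definition induced_functor ::
    "('p, 'b) category \<Rightarrow> 'b set \<Rightarrow> ('o, 'a, 'p, 'b) cat_functor
     \<Rightarrow> ('o, ('o, 'a) loc_arrow, 'p, ('p, 'b) loc_arrow) cat_functor" where
  "induced_functor D W' F =
     \<lparr>ob = ob F,
      ar = (\<lambda>(a, P, b). (ob F a,
              \<Union>p\<in>P. zigzag_class D W' (ob F a) (ob F b) (map (map_zigzag_step (ar F)) p),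
              ob F b))\<rparr>"


section \<open>Cohomology of a small category\<close>

type_synonym ('o, 'a, 'z) complex_presheaf = "('o, 'a, 'z cochain_complex, 'z cochain_arrow) cat_functor"

type_synonym ('o, 'a, 'z) presheaf_arrow =
  "('o, 'a, 'z) complex_presheaf \<times> ('o \<Rightarrow> 'z cochain_arrow) \<times> ('o, 'a, 'z) complex_presheaf"

definition presheaf_category ::
    "'z set set \<Rightarrow> ('o, 'a) category
     \<Rightarrow> (('o, 'a, 'z) complex_presheaf, ('o, 'a, 'z) presheaf_arrow) category" where
  "presheaf_category \<V> A = functor_category (opposite A) (complex_category \<V>)"

definition objectwise_quasi_isomorphisms ::
    "'z set set \<Rightarrow> ('o, 'a) category \<Rightarrow> ('o, 'a, 'z) presheaf_arrow set" where
  "objectwise_quasi_isomorphisms \<V> A =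
     {(F, \<eta>, G) \<in> Arr (presheaf_category \<V> A). \<forall>a\<in>Obj A. \<eta> a \<in> quasi_isomorphisms \<V>}"

definition derived_category ::
    "'z set set \<Rightarrow> ('o, 'a) category
     \<Rightarrow> (('o, 'a, 'z) complex_presheaf,
         (('o, 'a, 'z) complex_presheaf, ('o, 'a, 'z) presheaf_arrow) loc_arrow) category" where
  "derived_category \<V> A =
     localization (presheaf_category \<V> A) (objectwise_quasi_isomorphisms \<V> A)"

text \<open>Composition with a functor \<open>p\<close> from \<open>A\<close> to \<open>B\<close>, mapping presheaves on \<open>B\<close> to presheaves on \<open>A\<close>.\<close>

definition precomposition ::
    "('o, 'a) category \<Rightarrow> ('o, 'a, 'p, 'b) cat_functor
     \<Rightarrow> (('p, 'b, 'z) complex_presheaf, ('p, 'b, 'z) presheaf_arrow,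
         ('o, 'a, 'z) complex_presheaf, ('o, 'a, 'z) presheaf_arrow) cat_functor" where
  "precomposition A p =
     (let pull = (\<lambda>X. \<lparr>ob = ob X \<circ> ob p, ar = ar X \<circ> ar p\<rparr>)
      in \<lparr>ob = pull, ar = (\<lambda>(X, \<eta>, Y). (pull X, \<lambda>a\<in>Obj A. \<eta> (ob p a), pull Y))\<rparr>)"

definition derived_pullback ::
    "'z set set \<Rightarrow> ('o, 'a) category
     \<Rightarrow> ((unit, unit, 'z) complex_presheaf,
         ((unit, unit, 'z) complex_presheaf, (unit, unit, 'z) presheaf_arrow) loc_arrow,
         ('o, 'a, 'z) complex_presheaf,
         (('o, 'a, 'z) complex_presheaf, ('o, 'a, 'z) presheaf_arrow) loc_arrow) cat_functor" where
  "derived_pullback \<V> A =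
     induced_functor (presheaf_category \<V> A) (objectwise_quasi_isomorphisms \<V> A)
       (precomposition A to_terminal)"

text \<open>A right adjoint is unique up to isomorphism; one is chosen.\<close>

definition derived_pushforward ::
    "'z set set \<Rightarrow> ('o, 'a) category
     \<Rightarrow> (('o, 'a, 'z) complex_presheaf,
         (('o, 'a, 'z) complex_presheaf, ('o, 'a, 'z) presheaf_arrow) loc_arrow,
         (unit, unit, 'z) complex_presheaf,
         ((unit, unit, 'z) complex_presheaf, (unit, unit, 'z) presheaf_arrow) loc_arrow) cat_functor"
  where
  "derived_pushforward \<V> A =
     (SOME R. right_adjoint (derived_category \<V> terminal_category) (derived_category \<V> A)
                (derived_pullback \<V> A) R)"

definition integers_object :: "'z set set \<Rightarrow> (unit, unit, 'z) complex_presheaf" where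
  "integers_object \<V> =
     \<lparr>ob = (\<lambda>_. integers_complex \<V>), ar = (\<lambda>_. Ident (complex_category \<V>) (integers_complex \<V>))\<rparr>"

text \<open>A presheaf on the terminal category is identified with its value at the unique object.\<close>

definition category_cohomology :: "'z set set \<Rightarrow> ('o, 'a) category \<Rightarrow> int \<Rightarrow> 'z set monoid" where
  "category_cohomology \<V> A n =
     complex_cohomology
       (ob (ob (derived_pushforward \<V> A) (ob (derived_pullback \<V> A) (integers_object \<V>))) ()) n"

end

theory Submission
  imports Defs "HOL-Library.Nat_Bijection"
begin

text \<open>
  If \<open>M\<close> satisfies \<open>\<phi>\<close>, then \<open>(M, id)\<close> is a terminal object \<open>t\<close> of \<open>A = models_over I S \<phi> M\<close>.  Hence
  evaluation of presheaves at \<open>t\<close> is right adjoint to the pullback from the terminal category: the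
  unit is the identity, and the counit at a presheaf \<open>Y\<close> is given by the restrictions
  \<open>Y t \<rightarrow> Y a\<close> along the unique arrows \<open>a \<rightarrow> t\<close>.  Both functors preserve objectwise
  quasi-isomorphisms, so the adjunction descends to the derived categories without any resolutions.
  By uniqueness of right adjoints the derived pushforward of the pullback of \<open>\<int>\<close> is \<open>\<int>\<close> up to
  isomorphism in the derived category, and cohomology is invariant under such isomorphisms.
\<close>

section \<open>Categories\<close>

text \<open>Arrows of the localization are arbitrary zigzags, not roofs, so a claim about them is
  settled for one forward step and for one formal inverse and then extended by concatenation.
  Strictness keeps this manageable: functions on \<open>unit\<close> are determined by their value
  at \<open>()\<close>, so pullback followed by evaluation returns the very same record. The unit is
  thus an equality, two conditions on the counit replace the triangle identities, and no coherence
  isomorphism has to be carried through zigzags.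

  Two of the definitions are choices. The pushforward is an arbitrary right adjoint, so evaluation
  serves twice: it shows that a right adjoint exists, and it is the one with which the chosen
  adjoint is compared. The copy of the integers is an arbitrary group carried by a member of the
  collection of V-small sets, so that collection must contain an infinite set and be closed under
  subsets; the closure also admits the zero groups in the other degrees.\<close>

lemma opposite_simps [simp]:
  "Obj (opposite C) = Obj C" "Arr (opposite C) = Arr C" "Ident (opposite C) = Ident C"
  "Homs (opposite C) a b = Homs C b a" "Comp (opposite C) g f = Comp C f g"
  by (auto simp: opposite_def Homs_def)

lemma category_opposite:
  assumes "category C"
  shows "category (opposite C)"
proof -
  interpret category C by fact
  show ?thesis
  proof
    fix f assume "f \<in> Arr (opposite C)"
    then show "Dom (opposite C) f \<in> Obj (opposite C) \<and> Cod (opposite C) f \<in> Obj (opposite C)"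
      using dom_cod by (simp add: opposite_def)
  next
    fix a b c d f g h
    assume "f \<in> Homs (opposite C) a b" "g \<in> Homs (opposite C) b c" "h \<in> Homs (opposite C) c d"
    then show "Comp (opposite C) h (Comp (opposite C) g f) =
        Comp (opposite C) (Comp (opposite C) h g) f"
      using assoc[of h d c g b f a] by simp
  qed (use ident comp ident_left ident_right in \<open>auto\<close>)
qed

lemma category_terminal: "category terminal_category"
  by unfold_locales (auto simp: terminal_category_def Homs_def)

section \<open>Functor categories\<close>

lemma Homs_functor_category:
  "h \<in> Homs (functor_category C D) F G \<longleftrightarrow>
     (\<exists>\<eta>. h = (F, \<eta>, G) \<and> cat_functor C D F \<and> cat_functor C D G \<and> \<eta> \<in> extensional (Obj C) \<and>
       (\<forall>a\<in>Obj C. \<eta> a \<in> Homs D (ob F a) (ob G a)) \<and>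
       (\<forall>a\<in>Obj C. \<forall>b\<in>Obj C. \<forall>f\<in>Homs C a b. Comp D (\<eta> b) (ar F f) = Comp D (ar G f) (\<eta> a)))"
  by (auto simp: Homs_def functor_category_def)

lemma functor_category_simps [simp]:
  "Obj (functor_category C D) = {F. cat_functor C D F}"
  "Ident (functor_category C D) F = (F, \<lambda>a\<in>Obj C. Ident D (ob F a), F)"
  "Comp (functor_category C D) (G', \<theta>, H) (F, \<eta>, G) = (F, \<lambda>a\<in>Obj C. Comp D (\<theta> a) (\<eta> a), H)"
  by (auto simp: functor_category_def)

lemma category_functor_category:
  assumes "category C" "category D"
  shows "category (functor_category C D)"
proof -
  interpret C: category C by fact
  interpret D: category D by fact
  show ?thesis
  proof
    fix f assume "f \<in> Arr (functor_category C D)"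
    then show "Dom (functor_category C D) f \<in> Obj (functor_category C D) \<and>
        Cod (functor_category C D) f \<in> Obj (functor_category C D)"
      by (auto simp: functor_category_def)
  next
    fix F assume "F \<in> Obj (functor_category C D)"
    then interpret F: cat_functor C D F by simp
    have "\<And>a b f. f \<in> Homs C a b \<Longrightarrow>
        Comp D (Ident D (ob F b)) (ar F f) = Comp D (ar F f) (Ident D (ob F a))"
      using F.ar D.ident_left D.ident_right by metis
    then show "Ident (functor_category C D) F \<in> Homs (functor_category C D) F F"
      using F.cat_functor_axioms F.ob D.ident by (auto simp: Homs_functor_category)
  next
    fix F G H f g
    assume "f \<in> Homs (functor_category C D) F G" "g \<in> Homs (functor_category C D) G H"
    then obtain \<eta> \<theta> where
        f: "f = (F, \<eta>, G)" "\<And>a. a \<in> Obj C \<Longrightarrow> \<eta> a \<in> Homs D (ob F a) (ob G a)"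
          "\<And>a b f. a \<in> Obj C \<Longrightarrow> b \<in> Obj C \<Longrightarrow> f \<in> Homs C a b \<Longrightarrow>
             Comp D (\<eta> b) (ar F f) = Comp D (ar G f) (\<eta> a)"
        and g: "g = (G, \<theta>, H)" "\<And>a. a \<in> Obj C \<Longrightarrow> \<theta> a \<in> Homs D (ob G a) (ob H a)"
          "\<And>a b f. a \<in> Obj C \<Longrightarrow> b \<in> Obj C \<Longrightarrow> f \<in> Homs C a b \<Longrightarrow>
             Comp D (\<theta> b) (ar G f) = Comp D (ar H f) (\<theta> a)"
        and FGH: "cat_functor C D F" "cat_functor C D G" "cat_functor C D H"
      by (auto simp: Homs_functor_category)
    have "Comp D (Comp D (\<theta> b) (\<eta> b)) (ar F k) = Comp D (ar H k) (Comp D (\<theta> a) (\<eta> a))"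
      if ab: "a \<in> Obj C" "b \<in> Obj C" and k: "k \<in> Homs C a b" for a b k
    proof -
      note K = cat_functor.ar[OF FGH(1) k] cat_functor.ar[OF FGH(2) k] cat_functor.ar[OF FGH(3) k]
      have "Comp D (Comp D (\<theta> b) (\<eta> b)) (ar F k) = Comp D (\<theta> b) (Comp D (ar G k) (\<eta> a))"
        using D.assoc[OF K(1) f(2)[OF ab(2)] g(2)[OF ab(2)]] f(3)[OF ab k] by simp
      also have "\<dots> = Comp D (Comp D (ar H k) (\<theta> a)) (\<eta> a)"
        using D.assoc[OF f(2)[OF ab(1)] K(2) g(2)[OF ab(2)]] g(3)[OF ab k] by simp
      also have "\<dots> = Comp D (ar H k) (Comp D (\<theta> a) (\<eta> a))"
        using D.assoc[OF f(2)[OF ab(1)] g(2)[OF ab(1)] K(3)] by simp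
      finally show ?thesis .
    qed
    then show "Comp (functor_category C D) g f \<in> Homs (functor_category C D) F H"
      using FGH f(1) g(1) D.comp[OF f(2) g(2)] by (auto simp: Homs_functor_category)
  next
    fix F G f assume "f \<in> Homs (functor_category C D) F G"
    then obtain \<eta> where f: "f = (F, \<eta>, G)" "\<And>a. a \<in> Obj C \<Longrightarrow> \<eta> a \<in> Homs D (ob F a) (ob G a)"
        "\<eta> \<in> extensional (Obj C)"
      by (auto simp: Homs_functor_category)
    have "(\<lambda>a\<in>Obj C. Comp D (Ident D (ob G a)) (\<eta> a)) = \<eta>"
      using f(3) by (rule extensionalityI[OF restrict_extensional]) (simp add: D.ident_left[OF f(2)])
    then show "Comp (functor_category C D) (Ident (functor_category C D) G) f = f"
      using f(1) by (simp cong: restrict_cong)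
    have "(\<lambda>a\<in>Obj C. Comp D (\<eta> a) (Ident D (ob F a))) = \<eta>"
      using f(3) by (rule extensionalityI[OF restrict_extensional]) (simp add: D.ident_right[OF f(2)])
    then show "Comp (functor_category C D) f (Ident (functor_category C D) F) = f"
      using f(1) by (simp cong: restrict_cong)
  next
    fix F G H K f g h
    assume "f \<in> Homs (functor_category C D) F G" "g \<in> Homs (functor_category C D) G H"
      "h \<in> Homs (functor_category C D) H K"
    then obtain \<eta> \<theta> \<zeta> where f: "f = (F, \<eta>, G)" "\<And>a. a \<in> Obj C \<Longrightarrow> \<eta> a \<in> Homs D (ob F a) (ob G a)"
        and g: "g = (G, \<theta>, H)" "\<And>a. a \<in> Obj C \<Longrightarrow> \<theta> a \<in> Homs D (ob G a) (ob H a)"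
        and h: "h = (H, \<zeta>, K)" "\<And>a. a \<in> Obj C \<Longrightarrow> \<zeta> a \<in> Homs D (ob H a) (ob K a)"
      by (auto simp: Homs_functor_category)
    show "Comp (functor_category C D) h (Comp (functor_category C D) g f) =
        Comp (functor_category C D) (Comp (functor_category C D) h g) f"
      by (simp add: f(1) g(1) h(1) D.assoc[OF f(2) g(2) h(2)] cong: restrict_cong)
  qed
qed

subsection \<open>Adjunctions\<close>

text \<open>This is the Yoneda argument: for fixed \<open>y\<close>, both \<open>ob G y\<close> and
  \<open>ob G' y\<close> represent the functor that sends \<open>x\<close> to the arrows from
  \<open>ob F x\<close> to \<open>y\<close>, so their universal elements factor through each
  other.\<close>

lemma right_adjoint_unique:
  assumes "right_adjoint C D F G" "right_adjoint C D F G'" and y: "y \<in> Obj D"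
  shows "isomorphic C (ob G y) (ob G' y)"
proof -
  \<comment> \<open>Putting the identity of \<open>y\<close> for \<open>g\<close> in the naturality
    law leaves naturality in \<open>x\<close>, in a form that serves both adjoints.\<close>
  have half: "\<exists>\<Phi>. (\<forall>x\<in>Obj C. bij_betw (\<Phi> x) (Homs D (ob F x) y) (Homs C x (ob G y))) \<and>
      (\<forall>x\<in>Obj C. \<forall>x'\<in>Obj C. \<forall>f\<in>Homs C x' x. \<forall>h\<in>Homs D (ob F x) y.
         \<Phi> x' (Comp D h (ar F f)) = Comp C (\<Phi> x h) f)"
    if "right_adjoint C D F G" for G
  proof -
    from that obtain \<Phi> where F: "cat_functor C D F" and G: "cat_functor D C G"
      and bij: "\<And>x y. x\<in>Obj C \<Longrightarrow> y\<in>Obj D \<Longrightarrow>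
         bij_betw (\<Phi> x y) (Homs D (ob F x) y) (Homs C x (ob G y))"
      and nat: "\<And>x x' y y' f g h. x\<in>Obj C \<Longrightarrow> x'\<in>Obj C \<Longrightarrow> y\<in>Obj D \<Longrightarrow> y'\<in>Obj D \<Longrightarrow>
         f\<in>Homs C x' x \<Longrightarrow> h\<in>Homs D (ob F x) y \<Longrightarrow> g\<in>Homs D y y' \<Longrightarrow>
         \<Phi> x' y' (Comp D g (Comp D h (ar F f))) = Comp C (ar G g) (Comp C (\<Phi> x y h) f)"
      unfolding right_adjoint_def by metis
    interpret F: cat_functor C D F by fact
    interpret G: cat_functor D C G by fact
    have "\<Phi> x' y (Comp D h (ar F f)) = Comp C (\<Phi> x y h) f"
      if x: "x \<in> Obj C" "x' \<in> Obj C" and f: "f \<in> Homs C x' x" and h: "h \<in> Homs D (ob F x) y"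
      for x x' f h
    proof -
      have "\<Phi> x y h \<in> Homs C x (ob G y)"
        using bij[OF x(1) y] h by (auto simp: bij_betw_def)
      then have "Comp C (\<Phi> x y h) f \<in> Homs C x' (ob G y)"
        using f F.src.comp by blast
      moreover have "Comp D h (ar F f) \<in> Homs D (ob F x') y"
        using F.tgt.comp F.ar f h by blast
      ultimately show ?thesis
        using nat[OF x y y f h F.tgt.ident[OF y]] G.ar_ident[OF y]
          F.src.ident_left F.tgt.ident_left by simp
    qed
    then show ?thesis using bij y by (intro exI[of _ "\<lambda>x. \<Phi> x y"]) blast
  qed
  obtain \<Phi> where bij: "\<And>x. x\<in>Obj C \<Longrightarrow> bij_betw (\<Phi> x) (Homs D (ob F x) y) (Homs C x (ob G y))"
    and nat: "\<And>x x' f h. x\<in>Obj C \<Longrightarrow> x'\<in>Obj C \<Longrightarrow> f\<in>Homs C x' x \<Longrightarrow> h\<in>Homs D (ob F x) y \<Longrightarrow>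
         \<Phi> x' (Comp D h (ar F f)) = Comp C (\<Phi> x h) f"
    using half[OF assms(1)] by metis
  obtain \<Phi>' where bij': "\<And>x. x\<in>Obj C \<Longrightarrow> bij_betw (\<Phi>' x) (Homs D (ob F x) y) (Homs C x (ob G' y))"
    and nat': "\<And>x x' f h. x\<in>Obj C \<Longrightarrow> x'\<in>Obj C \<Longrightarrow> f\<in>Homs C x' x \<Longrightarrow> h\<in>Homs D (ob F x) y \<Longrightarrow>
         \<Phi>' x' (Comp D h (ar F f)) = Comp C (\<Phi>' x h) f"
    using half[OF assms(2)] by metis
  interpret F: cat_functor C D F using assms(1) by (simp add: right_adjoint_def)
  have Gy: "ob G y \<in> Obj C" and G'y: "ob G' y \<in> Obj C"
    using assms(1,2) cat_functor.ob[OF _ y] unfolding right_adjoint_def by metis+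
  \<comment> \<open>\<open>e\<close> and \<open>e'\<close> are the two counits at \<open>y\<close>,
    found as preimages of identities.\<close>
  obtain e where e: "e \<in> Homs D (ob F (ob G y)) y" "\<Phi> (ob G y) e = Ident C (ob G y)"
    using bij[OF Gy] F.src.ident[OF Gy] unfolding bij_betw_def by (metis imageE)
  obtain e' where e': "e' \<in> Homs D (ob F (ob G' y)) y" "\<Phi>' (ob G' y) e' = Ident C (ob G' y)"
    using bij'[OF G'y] F.src.ident[OF G'y] unfolding bij_betw_def by (metis imageE)
  define f where "f = \<Phi>' (ob G y) e"
  define g where "g = \<Phi> (ob G' y) e'"
  have f: "f \<in> Homs C (ob G y) (ob G' y)"
    using bij'[OF Gy] e(1) unfolding f_def bij_betw_def by blast
  have g: "g \<in> Homs C (ob G' y) (ob G y)"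
    using bij[OF G'y] e'(1) unfolding g_def bij_betw_def by blast
  \<comment> \<open>Both sides are \<open>f\<close>, so injectivity of \<open>\<Phi>'\<close> gives
    a factorization of \<open>e\<close> through \<open>e'\<close>; the second factorization is
    symmetric.\<close>
  have "\<Phi>' (ob G y) (Comp D e' (ar F f)) = \<Phi>' (ob G y) e"
    using nat'[OF G'y Gy f e'(1)] e'(2) F.src.ident_left[OF f] f_def by simp
  then have ef: "Comp D e' (ar F f) = e"
    using bij'[OF Gy] e(1) F.tgt.comp[OF F.ar[OF f] e'(1)] unfolding bij_betw_def inj_on_def by blast
  have "\<Phi> (ob G' y) (Comp D e (ar F g)) = \<Phi> (ob G' y) e'"
    using nat[OF Gy G'y g e(1)] e(2) F.src.ident_left[OF g] g_def by simp
  then have eg: "Comp D e (ar F g) = e'"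
    using bij[OF G'y] e'(1) F.tgt.comp[OF F.ar[OF g] e(1)] unfolding bij_betw_def inj_on_def by blast
  have "Comp C g f = Ident C (ob G y)"
    using nat[OF G'y Gy f e'(1)] ef e(2) g_def by simp
  moreover have "Comp C f g = Ident C (ob G' y)"
    using nat'[OF Gy G'y g e(1)] eg e'(2) f_def by simp
  ultimately show ?thesis
    using f g unfolding isomorphic_def by blast
qed

text \<open>As \<open>G\<close> after \<open>F\<close> is the identity on the nose, the triangle
  identities shrink to \<open>counit_F\<close> and \<open>G_counit\<close>. Transposition is
  \<open>ar G\<close> itself, and its inverse sends \<open>k\<close> to the counit after
  \<open>ar F k\<close>.\<close>

lemma right_adjoint_of_counit:
  assumes "cat_functor C D F" "cat_functor D C G"
    and ob_GF: "\<And>x. x \<in> Obj C \<Longrightarrow> ob G (ob F x) = x"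
    and ar_GF: "\<And>x y f. f \<in> Homs C x y \<Longrightarrow> ar G (ar F f) = f"
    and counit: "\<And>y. y \<in> Obj D \<Longrightarrow> \<epsilon> y \<in> Homs D (ob F (ob G y)) y"
    and natural: "\<And>y z h. h \<in> Homs D y z \<Longrightarrow> Comp D (\<epsilon> z) (ar F (ar G h)) = Comp D h (\<epsilon> y)"
    and counit_F: "\<And>x. x \<in> Obj C \<Longrightarrow> \<epsilon> (ob F x) = Ident D (ob F x)"
    and G_counit: "\<And>y. y \<in> Obj D \<Longrightarrow> ar G (\<epsilon> y) = Ident C (ob G y)"
  shows "right_adjoint C D F G"
proof -
  interpret F: cat_functor C D F by fact
  interpret G: cat_functor D C G by fact
  have ar_G: "ar G h \<in> Homs C x (ob G y)" if "x \<in> Obj C" "h \<in> Homs D (ob F x) y" for x y h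
    using G.ar[OF that(2)] ob_GF[OF that(1)] by simp
  have bij: "bij_betw (ar G) (Homs D (ob F x) y) (Homs C x (ob G y))"
    if x: "x \<in> Obj C" and y: "y \<in> Obj D" for x y
  proof (rule bij_betw_byWitness[where f' = "\<lambda>k. Comp D (\<epsilon> y) (ar F k)"])
    show "\<forall>h\<in>Homs D (ob F x) y. Comp D (\<epsilon> y) (ar F (ar G h)) = h"
      using natural F.tgt.ident_right counit_F[OF x] by metis
    show "\<forall>k\<in>Homs C x (ob G y). ar G (Comp D (\<epsilon> y) (ar F k)) = k"
      using G.ar_comp[OF F.ar counit[OF y]] ar_GF F.src.ident_left G_counit[OF y] by metis
    show "ar G ` Homs D (ob F x) y \<subseteq> Homs C x (ob G y)"
      using ar_G[OF x] by blast
    show "(\<lambda>k. Comp D (\<epsilon> y) (ar F k)) ` Homs C x (ob G y) \<subseteq> Homs D (ob F x) y"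
      using F.tgt.comp[OF F.ar counit[OF y]] by blast
  qed
  have "ar G (Comp D g (Comp D h (ar F f))) = Comp C (ar G g) (Comp C (ar G h) f)"
    if "f \<in> Homs C x' x" "h \<in> Homs D (ob F x) y" "g \<in> Homs D y y'" for x x' y y' f g h
    using G.ar_comp[OF F.tgt.comp[OF F.ar[OF that(1)] that(2)] that(3)]
      G.ar_comp[OF F.ar[OF that(1)] that(2)] ar_GF[OF that(1)] by simp
  then show ?thesis
    unfolding right_adjoint_def using assms(1,2) bij by (intro conjI exI[of _ "\<lambda>_ _. ar G"]) blast+
qed

section \<open>Localization\<close>

locale inverted_arrows = category C for C :: "('o, 'a) category" +
  fixes W :: "'a set"
  assumes W_Arr: "W \<subseteq> Arr C"
begin

abbreviation zz where "zz \<equiv> zigzag C W"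
abbreviation zeq where "zeq \<equiv> zigzag_eq C W"
abbreviation cls where "cls \<equiv> zigzag_class C W"

lemma step_objects: "step_ok C W s \<Longrightarrow> step_from C s \<in> Obj C \<and> step_to C s \<in> Obj C"
  using W_Arr dom_cod by (cases s) auto

lemma zigzag_objects: "zz a p b \<Longrightarrow> a \<in> Obj C \<and> b \<in> Obj C"
  by (induction p arbitrary: a) (use step_objects in auto)

lemma zigzag_append: "zz a p b \<Longrightarrow> zz b q c \<Longrightarrow> zz a (p @ q) c"
  by (induction p arbitrary: a) auto

lemma zigzag_single:
  "f \<in> Homs C a b \<Longrightarrow> zz a [Fwd f] b"
  "w \<in> W \<Longrightarrow> w \<in> Homs C a b \<Longrightarrow> zz b [Inv w] a"
  using dom_cod by (auto simp: Homs_def)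

lemma zigzag_eq_zigzag: "zeq a b p q \<Longrightarrow> zz a p b \<and> zz a q b"
proof (induction rule: zigzag_eq.induct)
  case (comp f a b g c)
  then show ?case
    using Defs.category.comp[OF category_axioms comp] dom_cod by (auto simp: Homs_def)
qed (use ident dom_cod in \<open>auto simp: Homs_def intro: zigzag_append\<close>)

text \<open>The congruence rule changes one factor at a time, so \<open>p\<close> is replaced while
  \<open>q\<close> stays, and then \<open>q\<close>. Composition of classes is well defined for this
  reason.\<close>

lemma zeq_append:
  assumes "zeq a b p p'" "zeq b c q q'"
  shows "zeq a c (p @ q) (p' @ q')"
proof -
  have "zz a p b" "zz a p' b" "zz b q c" "zz b q' c"
    using zigzag_eq_zigzag assms by blast+
  then have "zeq a c ([] @ p @ q) ([] @ p' @ q)" "zeq a c (p' @ q @ []) (p' @ q' @ [])"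
    using zigzag_eq.congruence[of C W a "[]" a b p p' q c]
      zigzag_eq.congruence[of C W a p' b c q q' "[]" c] assms zigzag_objects by auto
  then show ?thesis by (auto intro: zigzag_eq.trans)
qed

text \<open>The hypothesis matters: a list that is not a zigzag from \<open>a\<close> to
  \<open>b\<close> has the empty class, so two such lists have equal classes without being
  equivalent.\<close>

lemma cls_eq_iff: "zz a p b \<Longrightarrow> cls a b p = cls a b q \<longleftrightarrow> zeq a b p q"
  unfolding zigzag_class_def
  by (auto intro: zigzag_eq.trans zigzag_eq.sym zigzag_eq.refl)

lemma Homs_localization:
  "h \<in> Homs (localization C W) a b \<longleftrightarrow> (\<exists>p. zz a p b \<and> h = (a, cls a b p, b))"
  by (auto simp: Homs_def localization_def)

lemma Obj_localization [simp]: "Obj (localization C W) = Obj C"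
  by (simp add: localization_def)

lemma Ident_localization: "Ident (localization C W) a = (a, cls a a [], a)"
  by (simp add: localization_def)

text \<open>The union in the definition of composition runs over a constant family, and the family
  is nonempty because \<open>p\<close> and \<open>q\<close> represent their own classes.\<close>

lemma Comp_localization:
  assumes "zz a p b" "zz b q c"
  shows "Comp (localization C W) (b, cls b c q, c) (a, cls a b p, b) = (a, cls a c (p @ q), c)"
proof -
  have "cls a c (p' @ q') = cls a c (p @ q)" if "p' \<in> cls a b p" "q' \<in> cls b c q" for p' q'
    using that assms zeq_append zigzag_append cls_eq_iff unfolding zigzag_class_def
    by (metis mem_Collect_eq)
  moreover have "p \<in> cls a b p" "q \<in> cls b c q"
    using assms by (auto simp: zigzag_class_def intro: zigzag_eq.refl)
  ultimately have "(\<Union>p'\<in>cls a b p. \<Union>q'\<in>cls b c q. cls a c (p' @ q')) = cls a c (p @ q)"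
    by blast
  then show ?thesis by (simp add: localization_def)
qed

lemma category_localization: "category (localization C W)"
proof
  fix f assume "f \<in> Arr (localization C W)"
  then show "Dom (localization C W) f \<in> Obj (localization C W) \<and>
      Cod (localization C W) f \<in> Obj (localization C W)"
    using zigzag_objects by (auto simp: localization_def)
next
  fix a assume "a \<in> Obj (localization C W)"
  then show "Ident (localization C W) a \<in> Homs (localization C W) a a"
    by (auto simp: Homs_localization Ident_localization intro!: exI[of _ "[]"])
next
  fix a b c f g
  assume "f \<in> Homs (localization C W) a b" "g \<in> Homs (localization C W) b c"
  then show "Comp (localization C W) g f \<in> Homs (localization C W) a c"
    using Comp_localization zigzag_append by (fastforce simp: Homs_localization)
next
  fix a b f assume f: "f \<in> Homs (localization C W) a b"
  then obtain p where p: "zz a p b" "f = (a, cls a b p, b)" by (auto simp: Homs_localization)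
  with zigzag_objects have "zz a [] a" "zz b [] b" by auto
  then show "Comp (localization C W) (Ident (localization C W) b) f = f"
    "Comp (localization C W) f (Ident (localization C W) a) = f"
    using p Comp_localization by (force simp: Ident_localization)+
next
  fix a b c d f g h
  assume "f \<in> Homs (localization C W) a b" "g \<in> Homs (localization C W) b c"
    "h \<in> Homs (localization C W) c d"
  then obtain p q r where "zz a p b" "zz b q c" "zz c r d"
      "f = (a, cls a b p, b)" "g = (b, cls b c q, c)" "h = (c, cls c d r, d)"
    by (auto simp: Homs_localization)
  then show "Comp (localization C W) h (Comp (localization C W) g f) =
      Comp (localization C W) (Comp (localization C W) h g) f"
    using Comp_localization zigzag_append by simp
qed

text \<open>A group-valued functor on \<open>C\<close> that inverts \<open>W\<close> acts on zigzags, and the action only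
  depends on their classes.\<close>

lemma isomorphic_localization_imp_iso:
  fixes H :: "'o \<Rightarrow> ('g, 'm) monoid_scheme"
  assumes iso: "isomorphic (localization C W) a b"
    and group: "\<And>a. a \<in> Obj C \<Longrightarrow> group (H a)"
    and hom: "\<And>a b f. f \<in> Homs C a b \<Longrightarrow> h f \<in> hom (H a) (H b)"
    and h_ident: "\<And>a x. a \<in> Obj C \<Longrightarrow> x \<in> carrier (H a) \<Longrightarrow> h (Ident C a) x = x"
    and h_comp: "\<And>a b c f g x. f \<in> Homs C a b \<Longrightarrow> g \<in> Homs C b c \<Longrightarrow> x \<in> carrier (H a) \<Longrightarrow>
      h (Comp C g f) x = h g (h f x)"
    and h_W: "\<And>w. w \<in> W \<Longrightarrow> h w \<in> iso (H (Dom C w)) (H (Cod C w))"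
  shows "H a \<cong> H b"
proof -
  \<comment> \<open>A formal inverse acts by the inverse function, which is a homomorphism by
    \<open>h_W\<close>. In \<open>act\<close>, \<open>fold\<close> applies the head of the list
    first, in agreement with the diagrammatic order of zigzags.\<close>
  define step where "step s = (case s of Fwd f \<Rightarrow> h f
    | Inv w \<Rightarrow> inv_into (carrier (H (Dom C w))) (h w))" for s
  define act where "act p x = fold step p x" for p x
  have step: "step s \<in> hom (H (step_from C s)) (H (step_to C s))" if "step_ok C W s" for s
  proof (cases s)
    case (Fwd f)
    then show ?thesis using that hom by (auto simp: step_def Homs_def)
  next
    case (Inv w)
    then have w: "w \<in> W" using that by simp
    then have "group (H (Dom C w))" using group W_Arr dom_cod by blast
    from group.iso_set_sym[OF this h_W[OF w]] Inv show ?thesis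
      by (simp add: step_def iso_def)
  qed
  have act: "act p \<in> hom (H a) (H b)" if "zz a p b" for a p b
    using that
  proof (induction p arbitrary: a)
    case Nil
    then show ?case by (auto simp: act_def hom_def)
  next
    case (Cons s p)
    then have "act p \<in> hom (H (step_to C s)) (H b)" "step s \<in> hom (H a) (H (step_to C s))"
      using step by auto
    then have "act p \<circ> step s \<in> hom (H a) (H b)"
      by (rule hom_compose[rotated])
    then show ?case by (simp add: act_def comp_def)
  qed
  have closed: "act p x \<in> carrier (H b)" if "zz a p b" "x \<in> carrier (H a)" for a p b x
    using act[OF that(1)] that(2) by (auto simp: hom_def)
  have W_cancel: "inv_into (carrier (H a)) (h w) (h w x) = x" if "w \<in> W" "w \<in> Homs C a b" "x \<in> carrier (H a)"
    for a b w x
    using h_W[OF that(1)] that(2,3) by (auto simp: Homs_def iso_def bij_betw_def)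
  have W_cancel': "h w (inv_into (carrier (H a)) (h w) x) = x" if "w \<in> W" "w \<in> Homs C a b" "x \<in> carrier (H b)"
    for a b w x
    using h_W[OF that(1)] that(2,3) by (auto simp: Homs_def iso_def bij_betw_def f_inv_into_f)
  have act_eq: "act p x = act q x" if "zeq a b p q" "x \<in> carrier (H a)" for a b p q x
    using that
  proof (induction arbitrary: x rule: zigzag_eq.induct)
    \<comment> \<open>The common prefix \<open>u\<close> moves \<open>x\<close> to another element,
      so the induction has to leave \<open>x\<close> arbitrary; typing of \<open>u\<close> keeps
      that element in the carrier.\<close>
    case (congruence c u a b p q v d)
    have "act p (act u x) = act q (act u x)"
      using congruence closed by blast
    then show ?case by (simp add: act_def)
  next
    case (cancel_left w a b)
    then have "Dom C w = a" by (simp add: Homs_def)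
    with W_cancel[OF cancel_left] show ?case by (simp add: act_def step_def)
  next
    case (cancel_right w a b)
    then have "Dom C w = a" by (simp add: Homs_def)
    with W_cancel'[OF cancel_right] show ?case by (simp add: act_def step_def)
  qed (auto simp: act_def step_def h_ident h_comp)
  \<comment> \<open>Representatives of an isomorphism and of its inverse: both concatenations are
    equivalent to the empty zigzag, which acts as the identity.\<close>
  obtain p q where p: "zz a p b" and q: "zz b q a"
    and pq: "zeq a a (p @ q) []" and qp: "zeq b b (q @ p) []"
  proof -
    obtain p q where p: "zz a p b" and q: "zz b q a" and
      "(a, cls a a (p @ q), a) = (a, cls a a [], a)" "(b, cls b b (q @ p), b) = (b, cls b b [], b)"
      using iso by (auto simp: isomorphic_def Homs_localization Ident_localization Comp_localization)
    then show ?thesis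
      using that[OF p q] cls_eq_iff zigzag_append by blast
  qed
  have "bij_betw (act p) (carrier (H a)) (carrier (H b))"
  proof (rule bij_betw_byWitness[where f' = "act q"])
    show "\<forall>x\<in>carrier (H a). act q (act p x) = x" "\<forall>x\<in>carrier (H b). act p (act q x) = x"
      using act_eq[OF pq] act_eq[OF qp] by (auto simp: act_def)
  qed (use closed p q in auto)
  with act[OF p] show ?thesis by (auto simp: is_iso_def iso_def)
qed

end

section \<open>Functors and adjunctions between localizations\<close>

locale localized_functor = src: inverted_arrows C W + tgt: inverted_arrows D W' + F: cat_functor C D F
  for C :: "('o, 'a) category" and W and D :: "('p, 'b) category" and W' and F +
  assumes F_W: "w \<in> W \<Longrightarrow> ar F w \<in> W'"
begin

abbreviation F_zigzag where "F_zigzag \<equiv> map (map_zigzag_step (ar F))"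

lemma F_dom_cod: "f \<in> Arr C \<Longrightarrow> ar F f \<in> Arr D \<and> Dom D (ar F f) = ob F (Dom C f) \<and>
    Cod D (ar F f) = ob F (Cod C f)"
  using F.ar[of f "Dom C f" "Cod C f"] by (auto simp: Homs_def)

lemma zigzag_map: "src.zz a p b \<Longrightarrow> tgt.zz (ob F a) (F_zigzag p) (ob F b)"
proof (induction p arbitrary: a)
  case Nil
  then show ?case using F.ob by auto
next
  case (Cons s p)
  then show ?case
    using F_dom_cod F_W src.W_Arr by (cases s) (auto dest: subsetD)
qed

lemma zigzag_eq_map: "src.zeq a b p q \<Longrightarrow> tgt.zeq (ob F a) (ob F b) (F_zigzag p) (F_zigzag q)"
proof (induction rule: zigzag_eq.induct)
  case (refl a p b)
  then show ?case by (intro zigzag_eq.refl zigzag_map)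
next
  case (congruence c u a b p q v d)
  then show ?case by (simp add: zigzag_eq.congruence[OF zigzag_map _ zigzag_map])
next
  case (ident a)
  then show ?case using zigzag_eq.ident[of "ob F a" D W'] F.ob F.ar_ident by simp
next
  case (comp f a b g c)
  then show ?case using zigzag_eq.comp[OF F.ar F.ar] F.ar_comp by simp
next
  case (cancel_left w a b)
  then show ?case using zigzag_eq.cancel_left[OF F_W F.ar] by simp
next
  case (cancel_right w a b)
  then show ?case using zigzag_eq.cancel_right[OF F_W F.ar] by simp
qed (auto intro: zigzag_eq.sym zigzag_eq.trans)

lemma ob_induced [simp]: "ob (induced_functor D W' F) = ob F"
  by (simp add: induced_functor_def)

text \<open>As for composition, the union in \<open>induced_functor\<close> is over a constant
  nonempty family, because equivalent zigzags have equivalent images.\<close>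

lemma ar_induced:
  assumes "src.zz a p b"
  shows "ar (induced_functor D W' F) (a, src.cls a b p, b) =
    (ob F a, tgt.cls (ob F a) (ob F b) (F_zigzag p), ob F b)"
proof -
  have "tgt.cls (ob F a) (ob F b) (F_zigzag q) = tgt.cls (ob F a) (ob F b) (F_zigzag p)"
    if "q \<in> src.cls a b p" for q
    using that assms zigzag_eq_map tgt.cls_eq_iff zigzag_map by (metis mem_Collect_eq zigzag_class_def)
  moreover have "p \<in> src.cls a b p"
    using assms by (auto simp: zigzag_class_def intro: zigzag_eq.refl)
  ultimately have "(\<Union>q\<in>src.cls a b p. tgt.cls (ob F a) (ob F b) (F_zigzag q)) =
      tgt.cls (ob F a) (ob F b) (F_zigzag p)" by blast
  then show ?thesis by (simp add: induced_functor_def)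
qed

lemma cat_functor_induced:
  "cat_functor (localization C W) (localization D W') (induced_functor D W' F)"
proof -
  interpret LC: category "localization C W" by (rule src.category_localization)
  interpret LD: category "localization D W'" by (rule tgt.category_localization)
  show ?thesis
  proof
    show "ob (induced_functor D W' F) a \<in> Obj (localization D W')" if "a \<in> Obj (localization C W)" for a
      using that F.ob by simp
    show "ar (induced_functor D W' F) f \<in>
        Homs (localization D W') (ob (induced_functor D W' F) a) (ob (induced_functor D W' F) b)"
      if f: "f \<in> Homs (localization C W) a b" for a b f
    proof -
      obtain p where p: "src.zz a p b" "f = (a, src.cls a b p, b)"
        using f src.Homs_localization by blast
      show ?thesis
        using zigzag_map[OF p(1)] by (auto simp: p(2) ar_induced[OF p(1)] tgt.Homs_localization)
    qed
    show "ar (induced_functor D W' F) (Ident (localization C W) a) =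
        Ident (localization D W') (ob (induced_functor D W' F) a)"
      if "a \<in> Obj (localization C W)" for a
      using that ar_induced[of a "[]" a] by (simp add: src.Ident_localization tgt.Ident_localization)
    show "ar (induced_functor D W' F) (Comp (localization C W) g f) =
        Comp (localization D W') (ar (induced_functor D W' F) g) (ar (induced_functor D W' F) f)"
      if fg: "f \<in> Homs (localization C W) a b" "g \<in> Homs (localization C W) b c" for a b c f g
    proof -
      obtain p q where "src.zz a p b" "src.zz b q c" "f = (a, src.cls a b p, b)" "g = (b, src.cls b c q, c)"
        using fg by (auto simp: src.Homs_localization)
      then show ?thesis
        using zigzag_map src.zigzag_append
        by (simp add: src.Comp_localization tgt.Comp_localization ar_induced)
    qed
  qed
qed

end

text \<open>The counit survives as a family of one-step zigzags. What has to be proved anew is its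
  naturality, since the localization has more arrows than \<open>D\<close>: squares are pasted along
  a zigzag, and the square for a formal inverse comes from inverting the square for the arrow
  itself.\<close>

lemma right_adjoint_induced_functor:
  assumes "localized_functor C W D W' F" "localized_functor D W' C W G"
    and ob_GF: "\<And>x. x \<in> Obj C \<Longrightarrow> ob G (ob F x) = x"
    and ar_GF: "\<And>x y f. f \<in> Homs C x y \<Longrightarrow> ar G (ar F f) = f"
    and counit: "\<And>y. y \<in> Obj D \<Longrightarrow> \<epsilon> y \<in> Homs D (ob F (ob G y)) y"
    and natural: "\<And>y z h. h \<in> Homs D y z \<Longrightarrow> Comp D (\<epsilon> z) (ar F (ar G h)) = Comp D h (\<epsilon> y)"
    and counit_F: "\<And>x. x \<in> Obj C \<Longrightarrow> \<epsilon> (ob F x) = Ident D (ob F x)"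
    and G_counit: "\<And>y. y \<in> Obj D \<Longrightarrow> ar G (\<epsilon> y) = Ident C (ob G y)"
  shows "right_adjoint (localization C W) (localization D W')
    (induced_functor D W' F) (induced_functor C W G)"
proof -
  interpret F: localized_functor C W D W' F by fact
  interpret G: localized_functor D W' C W G by fact
  define \<eta> where "\<eta> y = (ob F (ob G y), F.tgt.cls (ob F (ob G y)) y [Fwd (\<epsilon> y)], y)" for y
  \<comment> \<open>An equality of lists and not only of classes: each step is fixed separately, and
    \<open>W_Arr\<close> makes \<open>ar_GF\<close> applicable to the arrow inside a formal
    inverse.\<close>
  have GF_zigzag: "G.F_zigzag (F.F_zigzag p) = p" if "F.src.zz x p y" for x y p
    using that
  proof (induction p arbitrary: x)
    case (Cons s p)
    then have "map_zigzag_step (ar G) (map_zigzag_step (ar F) s) = s"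
      using ar_GF F.src.W_Arr by (cases s) (auto simp: Homs_def)
    with Cons show ?case by auto
  qed simp
  have zigzag_counit: "F.tgt.zz (ob F (ob G y)) [Fwd (\<epsilon> y)] y" if "y \<in> Obj D" for y
    using counit[OF that] by (rule F.tgt.zigzag_single)
  have natural_zigzag: "F.tgt.zeq (ob F (ob G y)) z
      (F.F_zigzag (G.F_zigzag p) @ [Fwd (\<epsilon> z)]) (Fwd (\<epsilon> y) # p)" if "F.tgt.zz y p z" for y z p
    using that
  proof (induction p arbitrary: y)
    case Nil
    then show ?case using zigzag_counit by (auto intro: zigzag_eq.refl)
  next
    case (Cons s p)
    define t where "t = map_zigzag_step (ar F) (map_zigzag_step (ar G) s)"
    define x where "x = step_to D s"
    have y: "y = step_from D s" and s: "step_ok D W' s" and p: "F.tgt.zz x p z"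
      using Cons.prems by (auto simp: x_def)
    have xy: "x \<in> Obj D" "y \<in> Obj D"
      using F.tgt.step_objects[OF s] by (auto simp: x_def y)
    have s_zz: "F.tgt.zz y [s] x" using s xy by (simp add: x_def y)
    have t_zz: "F.tgt.zz (ob F (ob G y)) [t] (ob F (ob G x))"
      using F.zigzag_map[OF G.zigzag_map[OF s_zz]] by (simp add: t_def del: zigzag.simps)
    have square: "F.tgt.zeq (ob F (ob G y)) x [t, Fwd (\<epsilon> x)] [Fwd (\<epsilon> y), s]"
    proof (cases s)
      case (Fwd h)
      then have h: "h \<in> Homs D y x" using s by (simp add: x_def y Homs_def)
      have "F.tgt.zeq (ob F (ob G y)) x [t, Fwd (\<epsilon> x)] [Fwd (Comp D (\<epsilon> x) (ar F (ar G h)))]"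
        using zigzag_eq.comp[OF F.F.ar[OF G.F.ar[OF h]] counit[OF xy(1)]] Fwd by (simp add: t_def)
      moreover have "F.tgt.zeq (ob F (ob G y)) x [Fwd (\<epsilon> y), s] [Fwd (Comp D h (\<epsilon> y))]"
        using zigzag_eq.comp[OF counit[OF xy(2)] h] Fwd by simp
      ultimately show ?thesis
        using natural[OF h] by (auto intro: zigzag_eq.trans zigzag_eq.sym)
    next
      case (Inv w)
      then have w: "w \<in> W'" "w \<in> Homs D x y"
        using s F.tgt.W_Arr by (auto simp: x_def y Homs_def)
      \<comment> \<open>\<open>?v\<close> is again an inverted arrow because both functors preserve
        them. Put the formal inverse of \<open>?v\<close> before the naturality square of
        \<open>w\<close> and that of \<open>w\<close> after it; cancelling on either side leaves the
        square for \<open>Inv w\<close>.\<close>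
      let ?v = "ar F (ar G w)"
      have v: "?v \<in> W'" "?v \<in> Homs D (ob F (ob G x)) (ob F (ob G y))"
        using w F.F_W G.F_W F.F.ar G.F.ar by blast+
      have t: "t = Inv ?v" using Inv by (simp add: t_def)
      have "F.tgt.zeq (ob F (ob G x)) y [Fwd (\<epsilon> x), Fwd w] [Fwd ?v, Fwd (\<epsilon> y)]"
        using zigzag_eq.comp[OF counit[OF xy(1)] w(2)] zigzag_eq.comp[OF v(2) counit[OF xy(2)]]
          natural[OF w(2)] by (metis zigzag_eq.sym zigzag_eq.trans)
      then have "F.tgt.zeq (ob F (ob G y)) x ([t] @ [Fwd (\<epsilon> x), Fwd w] @ [Inv w])
          ([t] @ [Fwd ?v, Fwd (\<epsilon> y)] @ [Inv w])"
        using zigzag_eq.congruence[OF t_zz] s_zz Inv by blast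
      moreover have "F.tgt.zeq (ob F (ob G y)) x ([t, Fwd (\<epsilon> x)] @ [Fwd w, Inv w]) ([t, Fwd (\<epsilon> x)] @ [])"
        using F.tgt.zeq_append[OF zigzag_eq.refl[OF F.tgt.zigzag_append[OF t_zz zigzag_counit[OF xy(1)]]]
            zigzag_eq.cancel_left[OF w]] by simp
      moreover have "F.tgt.zeq (ob F (ob G y)) x ([t, Fwd ?v] @ [Fwd (\<epsilon> y), s]) ([] @ [Fwd (\<epsilon> y), s])"
        using F.tgt.zigzag_append[OF zigzag_counit[OF xy(2)] s_zz] zigzag_eq.cancel_right[OF v]
        by (intro F.tgt.zeq_append) (auto simp: t intro: zigzag_eq.refl)
      ultimately show ?thesis
        using Inv by (simp) (blast intro: zigzag_eq.trans zigzag_eq.sym)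
    qed
    \<comment> \<open>Pasting: the counit at \<open>z\<close> is first moved to \<open>x\<close>
      across the tail \<open>p\<close>, and then to \<open>y\<close> across the head
      \<open>s\<close>.\<close>
    have "F.tgt.zeq (ob F (ob G y)) z ([t] @ F.F_zigzag (G.F_zigzag p) @ [Fwd (\<epsilon> z)]) ([t] @ Fwd (\<epsilon> x) # p)"
      using zigzag_eq.refl[OF t_zz] Cons.IH[OF p] by (rule F.tgt.zeq_append)
    moreover have "F.tgt.zeq (ob F (ob G y)) z ([t, Fwd (\<epsilon> x)] @ p) ([Fwd (\<epsilon> y), s] @ p)"
      using square zigzag_eq.refl[OF p] by (rule F.tgt.zeq_append)
    ultimately show ?case
      by (auto simp: t_def intro: zigzag_eq.trans)
  qed
  show ?thesis
  proof (rule right_adjoint_of_counit[where \<epsilon> = \<eta>])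
    show "ar (induced_functor C W G) (ar (induced_functor D W' F) f) = f"
      if h: "f \<in> Homs (localization C W) x y" for x y f
    proof -
      obtain p where p: "F.src.zz x p y" "f = (x, F.src.cls x y p, y)"
        using h F.src.Homs_localization by blast
      show ?thesis
        using G.ar_induced[OF F.zigzag_map[OF p(1)]] F.src.zigzag_objects[OF p(1)]
        by (simp add: p(2) F.ar_induced[OF p(1)] GF_zigzag[OF p(1)] ob_GF del: map_map)
    qed
    show "\<eta> y \<in> Homs (localization D W')
        (ob (induced_functor D W' F) (ob (induced_functor C W G) y)) y"
      if "y \<in> Obj (localization D W')" for y
      using that zigzag_counit by (auto simp: F.tgt.Homs_localization \<eta>_def simp del: zigzag.simps)
    show "Comp (localization D W') (\<eta> z) (ar (induced_functor D W' F) (ar (induced_functor C W G) h)) =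
        Comp (localization D W') h (\<eta> y)" if h: "h \<in> Homs (localization D W') y z" for y z h
    proof -
      obtain p where p: "F.tgt.zz y p z" "h = (y, F.tgt.cls y z p, z)"
        using h F.tgt.Homs_localization by blast
      have yz: "y \<in> Obj D" "z \<in> Obj D" using F.tgt.zigzag_objects[OF p(1)] by auto
      note zz = F.zigzag_map[OF G.zigzag_map[OF p(1)]]
      have "F.tgt.cls (ob F (ob G y)) z (F.F_zigzag (G.F_zigzag p) @ [Fwd (\<epsilon> z)]) =
          F.tgt.cls (ob F (ob G y)) z ([Fwd (\<epsilon> y)] @ p)"
        using natural_zigzag[OF p(1)] F.tgt.zigzag_append[OF zz zigzag_counit[OF yz(2)]]
        by (simp add: F.tgt.cls_eq_iff)
      then show ?thesis
        by (simp add: p(2) G.ar_induced[OF p(1)] F.ar_induced[OF G.zigzag_map[OF p(1)]] \<eta>_def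
            F.tgt.Comp_localization[OF zz zigzag_counit[OF yz(2)]]
            F.tgt.Comp_localization[OF zigzag_counit[OF yz(1)] p(1)] del: append_Cons map_map)
    qed
    show "\<eta> (ob (induced_functor D W' F) x) = Ident (localization D W') (ob (induced_functor D W' F) x)"
      if "x \<in> Obj (localization C W)" for x
    proof -
      have x: "x \<in> Obj C" using that by simp
      then show ?thesis
        using zigzag_eq.ident[OF F.F.ob[OF x]] zigzag_counit[OF F.F.ob[OF x]]
        by (simp add: \<eta>_def F.tgt.Ident_localization ob_GF counit_F F.tgt.cls_eq_iff del: zigzag.simps)
    qed
    show "ar (induced_functor C W G) (\<eta> y) = Ident (localization C W) (ob (induced_functor C W G) y)"
      if "y \<in> Obj (localization D W')" for y
    proof -
      have y: "y \<in> Obj D" using that by simp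
      note zz = G.zigzag_map[OF zigzag_counit[OF y]]
      show ?thesis
        using zigzag_eq.ident[OF G.F.ob[OF y]] zz
        by (simp add: \<eta>_def F.src.Ident_localization G.ar_induced[OF zigzag_counit[OF y]]
            ob_GF[OF G.F.ob[OF y]] G_counit[OF y] F.src.cls_eq_iff del: zigzag.simps)
    qed
    show "ob (induced_functor C W G) (ob (induced_functor D W' F) x) = x"
      if "x \<in> Obj (localization C W)" for x
      using that ob_GF by simp
  qed (rule F.cat_functor_induced G.cat_functor_induced)+
qed

section \<open>Cochain complexes and their cohomology\<close>

lemma Homs_complex_category:
  "h \<in> Homs (complex_category \<V>) X Y \<longleftrightarrow>
     (\<exists>f. h = (X, f, Y) \<and> cochain_complex \<V> X \<and> cochain_complex \<V> Y \<and> cochain_map X Y f)"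
  by (auto simp: Homs_def complex_category_def)

lemma complex_category_simps [simp]:
  "Obj (complex_category \<V>) = {X. cochain_complex \<V> X}"
  "Ident (complex_category \<V>) X = (X, \<lambda>n. \<lambda>x\<in>carrier (Grp X n). x, X)"
  "Comp (complex_category \<V>) (Y', g, Z) (X, f, Y) = (X, \<lambda>n. compose (carrier (Grp X n)) (g n) (f n), Z)"
  by (auto simp: complex_category_def)

lemma category_complex_category: "category (complex_category \<V>)"
proof
  fix f assume "f \<in> Arr (complex_category \<V>)"
  then show "Dom (complex_category \<V>) f \<in> Obj (complex_category \<V>) \<and>
      Cod (complex_category \<V>) f \<in> Obj (complex_category \<V>)"
    by (auto simp: complex_category_def)
next
  fix X assume "X \<in> Obj (complex_category \<V>)"
  then have X: "cochain_complex \<V> X" by simp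
  then have "Diff X n x \<in> carrier (Grp X (n + 1))" if "x \<in> carrier (Grp X n)" for n x
    using that by (auto simp: cochain_complex_def hom_def)
  moreover have "group (Grp X n)" for n
    using X by (auto simp: cochain_complex_def comm_group_def)
  ultimately have "cochain_map X X (\<lambda>n. \<lambda>x\<in>carrier (Grp X n). x)"
    by (auto simp: cochain_map_def hom_def group.is_monoid monoid.m_closed)
  then show "Ident (complex_category \<V>) X \<in> Homs (complex_category \<V>) X X"
    using X by (simp add: Homs_complex_category)
next
  fix X Y Z f g
  assume "f \<in> Homs (complex_category \<V>) X Y" "g \<in> Homs (complex_category \<V>) Y Z"
  then obtain f' g' where f: "f = (X, f', Y)" "cochain_map X Y f'"
    and g: "g = (Y, g', Z)" "cochain_map Y Z g'"
    and XYZ: "cochain_complex \<V> X" "cochain_complex \<V> Y" "cochain_complex \<V> Z"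
    by (auto simp: Homs_complex_category)
  have "cochain_map X Z (\<lambda>n. compose (carrier (Grp X n)) (g' n) (f' n))"
    unfolding cochain_map_def
  proof (intro allI conjI ballI)
    fix n
    have hom: "f' n \<in> hom (Grp X n) (Grp Y n)" "g' n \<in> hom (Grp Y n) (Grp Z n)"
      using f g by (auto simp: cochain_map_def)
    have group: "group (Grp X n)"
      using XYZ by (auto simp: cochain_complex_def comm_group_def)
    then show "compose (carrier (Grp X n)) (g' n) (f' n) \<in> hom (Grp X n) (Grp Z n)"
      using group.hom_compose[OF group hom] by simp
    show "compose (carrier (Grp X n)) (g' n) (f' n) \<in> extensional (carrier (Grp X n))"
      by (rule compose_extensional)
    fix x assume x: "x \<in> carrier (Grp X n)"
    have "Diff X n x \<in> carrier (Grp X (n + 1))"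
      using x XYZ by (auto simp: cochain_complex_def hom_def)
    moreover have "f' n x \<in> carrier (Grp Y n)"
      using hom x by (auto simp: hom_def)
    ultimately show "compose (carrier (Grp X (n + 1))) (g' (n + 1)) (f' (n + 1)) (Diff X n x) =
        Diff Z n (compose (carrier (Grp X n)) (g' n) (f' n) x)"
      using f g x by (simp add: cochain_map_def compose_def)
  qed
  then show "Comp (complex_category \<V>) g f \<in> Homs (complex_category \<V>) X Z"
    using XYZ f g by (simp add: Homs_complex_category)
next
  fix X Y f assume "f \<in> Homs (complex_category \<V>) X Y"
  then obtain f' where f: "f = (X, f', Y)" "cochain_map X Y f'"
    by (auto simp: Homs_complex_category)
  \<comment> \<open>Extensionality of each component is what lets composition with a restricted
    identity return the component itself.\<close>
  then have *: "f' n \<in> carrier (Grp X n) \<rightarrow> carrier (Grp Y n)" "f' n \<in> extensional (carrier (Grp X n))" for n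
    by (auto simp: cochain_map_def hom_def)
  show "Comp (complex_category \<V>) (Ident (complex_category \<V>) Y) f = f"
    "Comp (complex_category \<V>) f (Ident (complex_category \<V>) X) = f"
    using Id_compose[OF *] compose_Id[OF *] by (simp_all add: f(1))
next
  fix X Y Z T f g h
  assume "f \<in> Homs (complex_category \<V>) X Y" "g \<in> Homs (complex_category \<V>) Y Z"
    "h \<in> Homs (complex_category \<V>) Z T"
  then obtain f' g' h' where "f = (X, f', Y)" "g = (Y, g', Z)" "h = (Z, h', T)"
      and f': "\<And>n. f' n \<in> carrier (Grp X n) \<rightarrow> carrier (Grp Y n)"
    by (auto simp: Homs_complex_category cochain_map_def hom_def)
  then show "Comp (complex_category \<V>) h (Comp (complex_category \<V>) g f) =
      Comp (complex_category \<V>) (Comp (complex_category \<V>) h g) f"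
    by (simp add: fun_eq_iff compose_assoc[OF f'])
qed

abbreviation cocycles where
  "cocycles X n \<equiv> kernel (Grp X n) (Grp X (n + 1)) (Diff X n)"

locale complex =
  fixes \<V> :: "'z set set" and X :: "'z cochain_complex"
  assumes complex: "cochain_complex \<V> X"
begin

lemma comm_group_Grp: "comm_group (Grp X n)"
  using complex by (simp add: cochain_complex_def)

lemma group_Grp: "group (Grp X n)"
  using comm_group_Grp by (simp add: comm_group_def)

lemma group_hom_Diff: "group_hom (Grp X n) (Grp X (n + 1)) (Diff X n)"
  using complex group_Grp by (auto simp: cochain_complex_def group_hom_def group_hom_axioms_def)

lemma subgroup_cocycles: "subgroup (cocycles X n) (Grp X n)"
  by (rule group_hom.subgroup_kernel[OF group_hom_Diff])

lemma subgroup_coboundaries: "subgroup (coboundaries X n) (Grp X n)"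
  using group_hom.img_is_subgroup[OF group_hom_Diff, of "n - 1"] by (simp add: coboundaries_def)

lemma coboundaries_subset: "coboundaries X n \<subseteq> cocycles X n"
proof
  fix y assume "y \<in> coboundaries X n"
  then obtain x where x: "x \<in> carrier (Grp X (n - 1))" "y = Diff X (n - 1) x"
    by (auto simp: coboundaries_def)
  have "Diff X (n - 1 + 1) (Diff X (n - 1) x) = \<one>\<^bsub>Grp X (n - 1 + 1 + 1)\<^esub>"
    using complex x(1) unfolding cochain_complex_def by blast
  moreover have "Diff X (n - 1) x \<in> carrier (Grp X (n - 1 + 1))"
    using group_hom.hom_closed[OF group_hom_Diff x(1)] .
  ultimately show "y \<in> cocycles X n" by (simp add: kernel_def x(2))
qed

lemma comm_group_cocycles: "comm_group (Grp X n\<lparr>carrier := cocycles X n\<rparr>)"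
  using group.group_comm_groupI[OF subgroup.subgroup_is_group[OF subgroup_cocycles group_Grp]]
    comm_group_Grp by (simp add: kernel_def comm_groupE(4))

lemma normal_coboundaries: "coboundaries X n \<lhd> Grp X n\<lparr>carrier := cocycles X n\<rparr>"
  using comm_group.subgroup_imp_normal[OF comm_group_cocycles]
    group.subgroup_incl[OF group_Grp subgroup_coboundaries subgroup_cocycles coboundaries_subset] .

lemma group_cohomology: "group (complex_cohomology X n)"
  unfolding complex_cohomology_def by (rule normal.factorgroup_is_group[OF normal_coboundaries])

abbreviation coset where "coset n x \<equiv> coboundaries X n #>\<^bsub>Grp X n\<^esub> x"

lemma carrier_cohomology: "carrier (complex_cohomology X n) = coset n ` cocycles X n"
  by (auto simp: complex_cohomology_def FactGroup_def RCOSETS_def r_coset_def)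

lemma mult_cohomology:
  assumes "x \<in> cocycles X n" "y \<in> cocycles X n"
  shows "coset n x \<otimes>\<^bsub>complex_cohomology X n\<^esub> coset n y = coset n (x \<otimes>\<^bsub>Grp X n\<^esub> y)"
  using normal.rcos_sum[OF normal_coboundaries, of x n y] assms
  by (simp add: complex_cohomology_def FactGroup_def r_coset_def set_mult_def)

lemma cocycles_carrier: "x \<in> cocycles X n \<Longrightarrow> x \<in> carrier (Grp X n)"
  by (simp add: kernel_def)

lemma cocycles_mult: "x \<in> cocycles X n \<Longrightarrow> y \<in> cocycles X n \<Longrightarrow> x \<otimes>\<^bsub>Grp X n\<^esub> y \<in> cocycles X n"
  using subgroup_cocycles by (rule subgroup.m_closed)

end

section \<open>Cochain maps and the maps they induce on cohomology\<close>

locale complex_map = X: complex \<V> X + Y: complex \<V> Y for \<V> :: "'z set set" and X Y +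
  fixes f
  assumes cochain_map: "cochain_map X Y f"
begin

lemma group_hom: "group_hom (Grp X n) (Grp Y n) (f n)"
  using cochain_map X.group_Grp Y.group_Grp
  by (auto simp: cochain_map_def group_hom_def group_hom_axioms_def)

lemma map_Diff: "x \<in> carrier (Grp X n) \<Longrightarrow> f (n + 1) (Diff X n x) = Diff Y n (f n x)"
  using cochain_map by (simp add: cochain_map_def)

lemma map_cocycles:
  assumes "x \<in> cocycles X n"
  shows "f n x \<in> cocycles Y n"
proof -
  have x: "x \<in> carrier (Grp X n)" "Diff X n x = \<one>\<^bsub>Grp X (n + 1)\<^esub>"
    using assms by (auto simp: kernel_def)
  then show ?thesis
    using map_Diff[OF x(1)] group_hom.hom_one[OF group_hom, of "n + 1"]
      group_hom.hom_closed[OF group_hom x(1)] by (simp add: kernel_def)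
qed

lemma map_coboundaries: "b \<in> coboundaries X n \<Longrightarrow> f n b \<in> coboundaries Y n"
  using map_Diff[of _ "n - 1"] group_hom.hom_closed[OF group_hom, of _ "n - 1"]
  by (auto simp: coboundaries_def)

text \<open>\<open>cohomology_map\<close> is a union over all representatives of a coset. Two
  representatives differ by a coboundary, which \<open>f\<close> sends to a coboundary, so every
  member of the union is the same coset.\<close>

lemma cohomology_map_coset:
  assumes x: "x \<in> cocycles X n"
  shows "cohomology_map (X, f, Y) n (X.coset n x) = Y.coset n (f n x)"
proof -
  have "Y.coset n (f n y) = Y.coset n (f n x)" if y: "y \<in> X.coset n x" for y
  proof -
    obtain b where b: "b \<in> coboundaries X n" "y = b \<otimes>\<^bsub>Grp X n\<^esub> x"
      using y by (auto simp: r_coset_def)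
    then have "b \<in> carrier (Grp X n)" "x \<in> carrier (Grp X n)"
      using x X.coboundaries_subset X.cocycles_carrier by blast+
    then have "f n y = f n b \<otimes>\<^bsub>Grp Y n\<^esub> f n x"
      using b group_hom.hom_mult[OF group_hom] by simp
    then have "f n y \<in> Y.coset n (f n x)"
      using map_coboundaries[OF b(1)] by (auto simp: r_coset_def)
    then show ?thesis
      using group.repr_independence[OF Y.group_Grp _ _ Y.subgroup_coboundaries]
        map_cocycles[OF x] Y.cocycles_carrier by metis
  qed
  moreover have "x \<in> X.coset n x"
    using group.rcos_self[OF X.group_Grp _ X.subgroup_coboundaries] X.cocycles_carrier[OF x] by blast
  ultimately have "(\<Union>y\<in>X.coset n x. Y.coset n (f n y)) = Y.coset n (f n x)"
    by (intro SUP_eq_const) blast+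
  then show ?thesis by (simp add: cohomology_map_def)
qed

lemma cohomology_map_hom:
  "cohomology_map (X, f, Y) n \<in> hom (complex_cohomology X n) (complex_cohomology Y n)"
proof (rule homI)
  fix c assume "c \<in> carrier (complex_cohomology X n)"
  then show "cohomology_map (X, f, Y) n c \<in> carrier (complex_cohomology Y n)"
    using map_cocycles by (auto simp: X.carrier_cohomology Y.carrier_cohomology cohomology_map_coset)
next
  fix c d assume "c \<in> carrier (complex_cohomology X n)" "d \<in> carrier (complex_cohomology X n)"
  then obtain x y where x: "x \<in> cocycles X n" "c = X.coset n x" and y: "y \<in> cocycles X n" "d = X.coset n y"
    by (auto simp: X.carrier_cohomology)
  have "f n (x \<otimes>\<^bsub>Grp X n\<^esub> y) = f n x \<otimes>\<^bsub>Grp Y n\<^esub> f n y"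
    using x y X.cocycles_carrier group_hom.hom_mult[OF group_hom] by blast
  then show "cohomology_map (X, f, Y) n (c \<otimes>\<^bsub>complex_cohomology X n\<^esub> d) =
      cohomology_map (X, f, Y) n c \<otimes>\<^bsub>complex_cohomology Y n\<^esub> cohomology_map (X, f, Y) n d"
    using x y map_cocycles X.cocycles_mult
    by (simp add: X.mult_cohomology Y.mult_cohomology cohomology_map_coset)
qed

end

lemma complex_map_iff:
  "(X, f, Y) \<in> Homs (complex_category \<V>) X' Y' \<longleftrightarrow> X' = X \<and> Y' = Y \<and> complex_map \<V> X Y f"
  by (auto simp: Homs_complex_category complex_map_def complex_map_axioms_def complex_def)

text \<open>This and the next lemma supply \<open>h_ident\<close> and \<open>h_comp\<close> for the
  action of cohomology on zigzags, where both laws are asked on carriers.\<close>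

lemma cohomology_map_ident:
  assumes "cochain_complex \<V> X" "c \<in> carrier (complex_cohomology X n)"
  shows "cohomology_map (Ident (complex_category \<V>) X) n c = c"
proof -
  interpret C: category "complex_category \<V>" by (rule category_complex_category)
  interpret complex_map \<V> X X "\<lambda>n. \<lambda>x\<in>carrier (Grp X n). x"
    using C.ident[of X] assms(1) by (simp add: complex_map_iff)
  show ?thesis
    using assms(2) cohomology_map_coset X.cocycles_carrier by (auto simp: X.carrier_cohomology)
qed

lemma cohomology_map_comp:
  assumes f: "f \<in> Homs (complex_category \<V>) X Y" and g: "g \<in> Homs (complex_category \<V>) Y Z"
    and c: "c \<in> carrier (complex_cohomology X n)"
  shows "cohomology_map (Comp (complex_category \<V>) g f) n c = cohomology_map g n (cohomology_map f n c)"
proof -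
  interpret C: category "complex_category \<V>" by (rule category_complex_category)
  obtain f' g' where f': "f = (X, f', Y)" and g': "g = (Y, g', Z)"
    using f g by (auto simp: Homs_complex_category)
  interpret f: complex_map \<V> X Y f' using f by (simp add: f' complex_map_iff)
  interpret g: complex_map \<V> Y Z g' using g by (simp add: g' complex_map_iff)
  interpret gf: complex_map \<V> X Z "\<lambda>n. compose (carrier (Grp X n)) (g' n) (f' n)"
    using C.comp[OF f g] by (simp add: f' g' complex_map_iff)
  show ?thesis
    using c f.cohomology_map_coset g.cohomology_map_coset gf.cohomology_map_coset
      f.map_cocycles f.X.cocycles_carrier
    by (auto simp: f.X.carrier_cohomology f' g' compose_def)
qed

subsection \<open>The integers\<close>

text \<open>Existence is at stake, since \<open>integers_copy\<close> is a choice. Addition is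
  transported along an injection of the integers into \<open>S\<close>; its range is a subset of
  \<open>S\<close> and hence an admissible carrier.\<close>

lemma integers_copy:
  assumes S: "infinite S" "\<And>T. T \<subseteq> S \<Longrightarrow> T \<in> \<V>"
  shows "comm_group (integers_copy \<V>) \<and> carrier (integers_copy \<V>) \<in> \<V> \<and>
    integers_copy \<V> \<cong> integer_group"
  unfolding integers_copy_def
proof (rule someI_ex)
  obtain f :: "nat \<Rightarrow> 'a" where f: "inj f" "range f \<subseteq> S"
    using infinite_countable_subset[OF S(1)] by blast
  \<comment> \<open>\<open>int_encode\<close> maps the integers bijectively onto the naturals, so
    \<open>h\<close> injects the integers into \<open>S\<close>.\<close>
  define h where "h = f \<circ> int_encode"
  have h: "inj h" "range h \<subseteq> S"
    using f bij_int_encode by (auto simp: h_def bij_def intro: inj_compose)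
  define k where "k = inv_into UNIV h"
  have k [simp]: "k (h x) = x" for x using h(1) by (simp add: k_def)
  define G where "G = \<lparr>carrier = range h, mult = (\<lambda>x y. h (k x + k y)), one = h 0\<rparr>"
  have G: "comm_group G"
  proof (rule comm_groupI)
    fix x assume "x \<in> carrier G"
    then show "\<exists>y\<in>carrier G. y \<otimes>\<^bsub>G\<^esub> x = \<one>\<^bsub>G\<^esub>"
      by (intro bexI[of _ "h (- k x)"]) (auto simp: G_def)
  qed (auto simp: G_def add_ac)
  have "k \<in> iso G integer_group"
  proof (rule isoI)
    show "k \<in> hom G integer_group"
      by (auto simp: hom_def G_def integer_group_def)
    show "bij_betw k (carrier G) (carrier integer_group)"
      by (rule bij_betw_byWitness[where f' = h]) (auto simp: G_def integer_group_def)
  qed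
  then have "G \<cong> integer_group" by (auto simp: is_iso_def)
  moreover have "carrier G \<in> \<V>" using S(2)[OF h(2)] by (simp add: G_def)
  ultimately show "\<exists>G :: 'a monoid. comm_group G \<and> carrier G \<in> \<V> \<and> G \<cong> integer_group" using G by blast
qed

context
  fixes \<V> :: "'z set set" and S
  assumes S: "infinite S" "\<And>T. T \<subseteq> S \<Longrightarrow> T \<in> \<V>"
    and subset: "\<And>A B. A \<in> \<V> \<Longrightarrow> B \<subseteq> A \<Longrightarrow> B \<in> \<V>"
begin

interpretation G: comm_group "integers_copy \<V>"
  using integers_copy[OF S] by blast

lemma one_Grp_integers [simp]: "\<one>\<^bsub>Grp (integers_complex \<V>) n\<^esub> = \<one>\<^bsub>integers_copy \<V>\<^esub>"
  and Diff_integers [simp]: "Diff (integers_complex \<V>) n x = \<one>\<^bsub>integers_copy \<V>\<^esub>"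
  by (simp_all add: integers_complex_def Let_def)

lemma Grp_integers:
  "Grp (integers_complex \<V>) n = (if n = 0 then integers_copy \<V>
     else integers_copy \<V>\<lparr>carrier := {\<one>\<^bsub>integers_copy \<V>\<^esub>}\<rparr>)"
  by (simp add: integers_complex_def Let_def)

lemma comm_group_Grp_integers: "comm_group (Grp (integers_complex \<V>) n)"
proof -
  have "comm_group (integers_copy \<V>\<lparr>carrier := {\<one>\<^bsub>integers_copy \<V>\<^esub>}\<rparr>)"
    by (rule comm_groupI) auto
  then show ?thesis using G.comm_group_axioms by (simp add: Grp_integers)
qed

text \<open>Outside degree 0 the group is carried by the singleton of the unit, which belongs to the
  collection because subsets of members do.\<close>

lemma complex_integers: "complex \<V> (integers_complex \<V>)"
proof -
  have G: "carrier (integers_copy \<V>) \<in> \<V>"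
    using integers_copy[OF S] by blast
  then have "{\<one>\<^bsub>integers_copy \<V>\<^esub>} \<in> \<V>"
    by (rule subset) auto
  with G have "carrier (Grp (integers_complex \<V>) n) \<in> \<V>" for n
    by (simp add: Grp_integers)
  moreover have "Diff (integers_complex \<V>) n \<in>
      hom (Grp (integers_complex \<V>) n) (Grp (integers_complex \<V>) (n + 1))" for n
    by (auto simp: hom_def Grp_integers)
  ultimately show ?thesis
    using comm_group_Grp_integers by (simp add: complex_def cochain_complex_def)
qed

interpretation Z: complex \<V> "integers_complex \<V>"
  by (rule complex_integers)

lemma cocycles_integers: "cocycles (integers_complex \<V>) n = carrier (Grp (integers_complex \<V>) n)"
  by (simp add: kernel_def)

lemma coset_integers:
  assumes "x \<in> carrier (Grp (integers_complex \<V>) n)"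
  shows "Z.coset n x = {x}"
proof -
  \<comment> \<open>The differential is constant, and the group in degree \<open>n - 1\<close>
    contains its unit, so the image is a singleton rather than empty.\<close>
  have "coboundaries (integers_complex \<V>) n = {\<one>\<^bsub>integers_copy \<V>\<^esub>}"
    using group.is_monoid[OF Z.group_Grp, of "n - 1"] monoid.one_closed
    by (fastforce simp: coboundaries_def)
  then show ?thesis
    using assms monoid.l_one[OF group.is_monoid[OF Z.group_Grp], of x n] by (simp add: r_coset_def)
qed

text \<open>With trivial differentials, passing to cohomology only replaces \<open>x\<close> by the
  coset \<open>{x}\<close>.\<close>

lemma cohomology_integers_0: "complex_cohomology (integers_complex \<V>) 0 \<cong> integer_group"
proof -
  have "(\<lambda>x. {x}) \<in> iso (integers_copy \<V>) (complex_cohomology (integers_complex \<V>) 0)"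
  proof (rule isoI)
    show "(\<lambda>x. {x}) \<in> hom (integers_copy \<V>) (complex_cohomology (integers_complex \<V>) 0)"
    proof (rule homI)
      fix x y assume "x \<in> carrier (integers_copy \<V>)" "y \<in> carrier (integers_copy \<V>)"
      then show "{x \<otimes>\<^bsub>integers_copy \<V>\<^esub> y} =
          {x} \<otimes>\<^bsub>complex_cohomology (integers_complex \<V>) 0\<^esub> {y}"
        using Z.mult_cohomology[of x 0 y, unfolded cocycles_integers] coset_integers[of _ 0]
        by (simp add: Grp_integers[of 0])
    qed (use coset_integers[of _ 0] in
        \<open>auto simp: Z.carrier_cohomology[unfolded cocycles_integers] Grp_integers[of 0] image_iff\<close>)
    show "bij_betw (\<lambda>x. {x}) (carrier (integers_copy \<V>))
        (carrier (complex_cohomology (integers_complex \<V>) 0))"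
      using coset_integers[of _ 0]
      by (auto simp: bij_betw_def Z.carrier_cohomology[unfolded cocycles_integers]
          Grp_integers[of 0] image_iff)
  qed
  then have "integers_copy \<V> \<cong> complex_cohomology (integers_complex \<V>) 0"
    by (auto simp: is_iso_def)
  then show ?thesis
    using integers_copy[OF S] G.iso_sym iso_trans by blast
qed

lemma cohomology_integers_nonzero:
  assumes "n \<noteq> 0"
  shows "trivial_group (complex_cohomology (integers_complex \<V>) n)"
  using group.trivial_group[OF Z.group_cohomology, of n] assms
  unfolding Z.carrier_cohomology cocycles_integers by (simp add: Grp_integers[of n])

end

section \<open>Presheaves of complexes\<close>

lemma category_presheaf_category: "category A \<Longrightarrow> category (presheaf_category \<V> A)"
  unfolding presheaf_category_def
  by (intro category_functor_category category_opposite category_complex_category)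

lemma inverted_objectwise_quasi_isomorphisms:
  "category A \<Longrightarrow> inverted_arrows (presheaf_category \<V> A) (objectwise_quasi_isomorphisms \<V> A)"
  unfolding inverted_arrows_def inverted_arrows_axioms_def
  using category_presheaf_category by (auto simp: objectwise_quasi_isomorphisms_def)

lemma ob_precomposition:
  "ob (precomposition A p) X = \<lparr>ob = ob X \<circ> ob p, ar = ar X \<circ> ar p\<rparr>"
  by (simp add: precomposition_def)

lemma ar_precomposition:
  "ar (precomposition A p) (X, \<eta>, Y) =
     (ob (precomposition A p) X, \<lambda>a\<in>Obj A. \<eta> (ob p a), ob (precomposition A p) Y)"
  by (simp add: precomposition_def)

text \<open>The component of a pulled-back arrow at \<open>a\<close> is the original component at
  \<open>ob p a\<close>, so a condition imposed object by object is inherited. A general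
  \<open>p\<close> covers both the pullback from the terminal category and evaluation.\<close>

lemma localized_functor_precomposition:
  assumes p: "cat_functor A B p"
  shows "localized_functor (presheaf_category \<V> B) (objectwise_quasi_isomorphisms \<V> B)
    (presheaf_category \<V> A) (objectwise_quasi_isomorphisms \<V> A) (precomposition A p)"
proof -
  interpret p: cat_functor A B p by fact
  interpret PA: inverted_arrows "presheaf_category \<V> A" "objectwise_quasi_isomorphisms \<V> A"
    using p.src.category_axioms by (rule inverted_objectwise_quasi_isomorphisms)
  interpret PB: inverted_arrows "presheaf_category \<V> B" "objectwise_quasi_isomorphisms \<V> B"
    using p.tgt.category_axioms by (rule inverted_objectwise_quasi_isomorphisms)
  have pull: "cat_functor (opposite A) (complex_category \<V>) (ob (precomposition A p) X)"
    if "cat_functor (opposite B) (complex_category \<V>) X" for X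
  proof -
    interpret X: cat_functor "opposite B" "complex_category \<V>" X by fact
    show ?thesis
      unfolding cat_functor_def cat_functor_axioms_def
    proof (intro conjI allI impI)
      fix a assume "a \<in> Obj (opposite A)"
      then have a: "a \<in> Obj A" by simp
      show "ob (ob (precomposition A p) X) a \<in> Obj (complex_category \<V>)"
        using X.ob p.ob a by (simp add: ob_precomposition)
      show "ar (ob (precomposition A p) X) (Ident (opposite A) a) =
          Ident (complex_category \<V>) (ob (ob (precomposition A p) X) a)"
        using X.ar_ident[of "ob p a"] p.ob a p.ar_ident[OF a] by (simp add: ob_precomposition)
    next
      fix a b f assume "f \<in> Homs (opposite A) a b"
      then show "ar (ob (precomposition A p) X) f \<in>
          Homs (complex_category \<V>) (ob (ob (precomposition A p) X) a) (ob (ob (precomposition A p) X) b)"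
        using X.ar[of "ar p f" "ob p a" "ob p b"] p.ar by (simp add: ob_precomposition)
    next
      fix a b c f g assume "f \<in> Homs (opposite A) a b" "g \<in> Homs (opposite A) b c"
      then show "ar (ob (precomposition A p) X) (Comp (opposite A) g f) =
          Comp (complex_category \<V>) (ar (ob (precomposition A p) X) g) (ar (ob (precomposition A p) X) f)"
        using X.ar_comp[of "ar p f" "ob p a" "ob p b" "ar p g" "ob p c"] p.ar p.ar_comp
        by (simp add: ob_precomposition)
    qed (rule category_opposite[OF p.src.category_axioms] category_complex_category)+
  qed
  have hom: "ar (precomposition A p) h \<in>
      Homs (presheaf_category \<V> A) (ob (precomposition A p) X) (ob (precomposition A p) Y)"
    if h: "h \<in> Homs (presheaf_category \<V> B) X Y" for h X Y
  proof -
    obtain \<eta> where \<eta>: "h = (X, \<eta>, Y)" "cat_functor (opposite B) (complex_category \<V>) X"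
        "cat_functor (opposite B) (complex_category \<V>) Y"
        "\<forall>a\<in>Obj B. \<eta> a \<in> Homs (complex_category \<V>) (ob X a) (ob Y a)"
        "\<forall>a\<in>Obj B. \<forall>b\<in>Obj B. \<forall>f\<in>Homs B b a.
           Comp (complex_category \<V>) (\<eta> b) (ar X f) = Comp (complex_category \<V>) (ar Y f) (\<eta> a)"
      using h by (simp add: presheaf_category_def Homs_functor_category) metis
    show ?thesis
      unfolding presheaf_category_def Homs_functor_category \<eta>(1) ar_precomposition
      using pull[OF \<eta>(2)] pull[OF \<eta>(3)] \<eta>(4,5) p.ob p.ar by (simp add: ob_precomposition)
  qed
  show ?thesis
  proof (intro localized_functor.intro localized_functor_axioms.intro cat_functor.intro
      cat_functor_axioms.intro)
    fix X assume "X \<in> Obj (presheaf_category \<V> B)"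
    then have X: "cat_functor (opposite B) (complex_category \<V>) X"
      by (simp add: presheaf_category_def)
    then show "ob (precomposition A p) X \<in> Obj (presheaf_category \<V> A)"
      using pull by (simp add: presheaf_category_def)
    show "ar (precomposition A p) (Ident (presheaf_category \<V> B) X) =
        Ident (presheaf_category \<V> A) (ob (precomposition A p) X)"
      using p.ob by (simp add: presheaf_category_def ar_precomposition ob_precomposition
          cong: restrict_cong del: complex_category_simps)
  next
    fix X Y Z f g
    assume "f \<in> Homs (presheaf_category \<V> B) X Y" "g \<in> Homs (presheaf_category \<V> B) Y Z"
    then obtain \<eta> \<theta> where "f = (X, \<eta>, Y)" "g = (Y, \<theta>, Z)"
      by (auto simp: presheaf_category_def Homs_functor_category)
    then show "ar (precomposition A p) (Comp (presheaf_category \<V> B) g f) =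
        Comp (presheaf_category \<V> A) (ar (precomposition A p) g) (ar (precomposition A p) f)"
      using p.ob by (simp add: presheaf_category_def ar_precomposition
          cong: restrict_cong del: complex_category_simps)
  next
    fix w assume "w \<in> objectwise_quasi_isomorphisms \<V> B"
    then obtain X \<eta> Y where w: "w = (X, \<eta>, Y)" "w \<in> Arr (presheaf_category \<V> B)"
        "\<forall>a\<in>Obj B. \<eta> a \<in> quasi_isomorphisms \<V>"
      by (auto simp: objectwise_quasi_isomorphisms_def)
    then have "w \<in> Homs (presheaf_category \<V> B) X Y"
      by (simp add: Homs_def presheaf_category_def functor_category_def)
    then have "ar (precomposition A p) w \<in> Arr (presheaf_category \<V> A)"
      using hom by (auto simp: Homs_def)
    then show "ar (precomposition A p) w \<in> objectwise_quasi_isomorphisms \<V> A"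
      using w(1,3) p.ob by (simp add: objectwise_quasi_isomorphisms_def ar_precomposition)
  qed (use hom in \<open>auto intro: PA.inverted_arrows_axioms PB.inverted_arrows_axioms
      PA.category_axioms PB.category_axioms\<close>)
qed

section \<open>Evaluation at a terminal object and the derived category of the point\<close>

lemma terminal_category_simps [simp]:
  "Obj terminal_category = UNIV" "Homs terminal_category x y = UNIV"
  by (auto simp: terminal_category_def Homs_def)

lemma cat_functor_to_terminal: "category A \<Longrightarrow> cat_functor A terminal_category to_terminal"
  using category_terminal by (simp add: cat_functor_def cat_functor_axioms_def)

text \<open>Evaluation at \<open>t\<close> is expressed as precomposition with this functor, so that
  the facts on precomposition apply to both sides of the adjunction.\<close>

definition point :: "('o, 'a) category \<Rightarrow> 'o \<Rightarrow> (unit, unit, 'o, 'a) cat_functor" where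
  "point A t = \<lparr>ob = (\<lambda>_. t), ar = (\<lambda>_. Ident A t)\<rparr>"

lemma point_simps [simp]: "ob (point A t) x = t" "ar (point A t) f = Ident A t"
  by (simp_all add: point_def)

lemma cat_functor_point:
  assumes "category A" "t \<in> Obj A"
  shows "cat_functor terminal_category A (point A t)"
proof -
  interpret category A by fact
  have "Ident A t \<in> Homs A t t" by (rule ident[OF assms(2)])
  then show ?thesis
    using category_terminal assms ident_left by (auto simp: cat_functor_def cat_functor_axioms_def point_def)
qed

locale category_with_terminal = category A for A :: "('o, 'a) category" +
  fixes t :: 'o and u :: "'o \<Rightarrow> 'a"
  assumes t: "t \<in> Obj A"
    and u: "a \<in> Obj A \<Longrightarrow> u a \<in> Homs A a t"
    and u_unique: "f \<in> Homs A a t \<Longrightarrow> f = u a"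
begin

lemma derived_pullback_right_adjoint:
  fixes \<V> :: "'z set set"
  shows "right_adjoint (derived_category \<V> terminal_category) (derived_category \<V> A) (derived_pullback \<V> A)
     (induced_functor (presheaf_category \<V> terminal_category)
       (objectwise_quasi_isomorphisms \<V> terminal_category)
       (precomposition terminal_category (point A t)))"
proof -
  let ?K = "complex_category \<V>"
  let ?F = "precomposition A to_terminal"
  let ?G = "precomposition terminal_category (point A t)"
  interpret K: category ?K by (rule category_complex_category)
  \<comment> \<open>The source is the constant presheaf with value \<open>ob Y t\<close>;
    contravariance turns \<open>u a\<close> into a map from \<open>ob Y t\<close> to
    \<open>ob Y a\<close>.\<close>
  define \<epsilon> where "\<epsilon> Y = (ob ?F (ob ?G Y), \<lambda>a\<in>Obj A. ar Y (u a), Y)"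
    for Y :: "('o, 'a, 'z) complex_presheaf"
  have GF: "ob ?G (ob ?F X) = X" for X :: "(unit, unit, 'z) complex_presheaf"
    by (cases X) (simp add: ob_precomposition comp_def)
  have F: "localized_functor (presheaf_category \<V> terminal_category)
      (objectwise_quasi_isomorphisms \<V> terminal_category)
      (presheaf_category \<V> A) (objectwise_quasi_isomorphisms \<V> A) ?F"
    by (intro localized_functor_precomposition cat_functor_to_terminal category_axioms)
  have G: "localized_functor (presheaf_category \<V> A) (objectwise_quasi_isomorphisms \<V> A)
      (presheaf_category \<V> terminal_category) (objectwise_quasi_isomorphisms \<V> terminal_category) ?G"
    by (intro localized_functor_precomposition cat_functor_point category_axioms t)
  show ?thesis
    unfolding derived_category_def derived_pullback_def
  proof (rule right_adjoint_induced_functor[OF F G GF, where \<epsilon> = \<epsilon>])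
    fix X Y f assume "f \<in> Homs (presheaf_category \<V> terminal_category) X Y"
    then obtain \<eta> where "f = (X, \<eta>, Y)"
      by (auto simp: presheaf_category_def Homs_functor_category)
    then show "ar ?G (ar ?F f) = f"
      using t by (simp add: ar_precomposition GF restrict_UNIV)
  next
    fix Y assume "Y \<in> Obj (presheaf_category \<V> A)"
    then have Y: "cat_functor (opposite A) ?K Y" by (simp add: presheaf_category_def)
    interpret Y: cat_functor "opposite A" ?K Y by fact
    have FGY: "cat_functor (opposite A) ?K (ob ?F (ob ?G Y))"
      using Y cat_functor.ob[OF localized_functor.axioms(3)[OF F]]
        cat_functor.ob[OF localized_functor.axioms(3)[OF G]]
      by (simp add: presheaf_category_def)
    have ob_FGY: "ob (ob ?F (ob ?G Y)) a = ob Y t" and ar_FGY: "ar (ob ?F (ob ?G Y)) f = ar Y (Ident A t)"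
      for a f by (simp_all add: ob_precomposition)
    have Yu: "ar Y (u a) \<in> Homs ?K (ob Y t) (ob Y a)" if "a \<in> Obj A" for a
      using Y.ar[of "u a" t a] u[OF that] by simp
    \<comment> \<open>The transition maps of the constant presheaf appear as
      \<open>ar Y (Ident A t)\<close>, an identity by functoriality. What remains is that
      \<open>u a\<close> after \<open>f\<close> is \<open>u b\<close>, by uniqueness of arrows into
      \<open>t\<close>.\<close>
    have "Comp ?K (ar Y (u b)) (ar Y (Ident A t)) = Comp ?K (ar Y f) (ar Y (u a))"
      if "a \<in> Obj A" "b \<in> Obj A" and f: "f \<in> Homs A b a" for a b f
    proof -
      have "Comp ?K (ar Y f) (ar Y (u a)) = ar Y (Comp A (u a) f)"
        using Y.ar_comp[of "u a" t a f b] u[OF that(1)] f by simp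
      also have "Comp A (u a) f = u b"
        using u_unique comp[OF f u[OF that(1)]] .
      finally show ?thesis
        using K.ident_right[OF Yu[OF that(2)]] Y.ar_ident[of t] t by simp
    qed
    then show "\<epsilon> Y \<in> Homs (presheaf_category \<V> A) (ob ?F (ob ?G Y)) Y"
      using Y FGY Yu unfolding \<epsilon>_def presheaf_category_def Homs_functor_category
      by (simp add: ob_FGY ar_FGY)
    have "u t = Ident A t" using u_unique[OF ident[OF t]] by simp
    then show "ar ?G (\<epsilon> Y) = Ident (presheaf_category \<V> terminal_category) (ob ?G Y)"
      using Y.ar_ident[of t] t
      by (simp add: \<epsilon>_def ar_precomposition GF presheaf_category_def  ob_precomposition[of _ _ Y]
          del: complex_category_simps)
  next
    fix Y Z h assume "h \<in> Homs (presheaf_category \<V> A) Y Z"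
    then obtain \<eta> where \<eta>: "h = (Y, \<eta>, Z)"
        "\<forall>a\<in>Obj A. \<forall>b\<in>Obj A. \<forall>f\<in>Homs A b a.
           Comp ?K (\<eta> b) (ar Y f) = Comp ?K (ar Z f) (\<eta> a)"
      by (simp add: presheaf_category_def Homs_functor_category) metis
    \<comment> \<open>Naturality of the counit in the presheaf is naturality of
      \<open>\<eta>\<close> at the arrow \<open>u a\<close>.\<close>
    then have "Comp ?K (\<eta> a) (ar Y (u a)) = Comp ?K (ar Z (u a)) (\<eta> t)" if "a \<in> Obj A" for a
      using that t u by blast
    then show "Comp (presheaf_category \<V> A) (\<epsilon> Z) (ar ?F (ar ?G h)) =
        Comp (presheaf_category \<V> A) h (\<epsilon> Y)"
      by (simp add: \<eta>(1) \<epsilon>_def ar_precomposition presheaf_category_def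
          cong: restrict_cong del: complex_category_simps)
  next
    fix X :: "(unit, unit, 'z) complex_presheaf"
    assume "X \<in> Obj (presheaf_category \<V> terminal_category)"
    then interpret X: cat_functor "opposite terminal_category" ?K X
      by (simp add: presheaf_category_def)
    \<comment> \<open>The only arrow of the terminal category is an identity, so all restrictions of
      a pulled-back presheaf are identities, and so is the counit there.\<close>
    have "ar X () = Ident ?K (ob X ())"
      using X.ar_ident[of "()"] by (simp del: complex_category_simps)
    moreover have "ob (ob ?F X) a = ob X ()" "ar (ob ?F X) f = ar X ()" for a f
      by (simp_all add: ob_precomposition)
    ultimately show "\<epsilon> (ob ?F X) = Ident (presheaf_category \<V> A) (ob ?F X)"
      by (simp add: \<epsilon>_def GF presheaf_category_def del: complex_category_simps)
  qed
qed

end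

text \<open>An isomorphism in the derived category need not come from a single cochain map.
  Cohomology in degree \<open>n\<close> inverts quasi-isomorphisms, so it acts on the zigzags that
  represent the isomorphism and its inverse.\<close>

lemma cohomology_iso_derived_terminal:
  assumes "isomorphic (derived_category \<V> terminal_category) X Y"
  shows "complex_cohomology (ob X ()) n \<cong> complex_cohomology (ob Y ()) n"
proof -
  let ?e = "terminal_category"
  interpret inverted_arrows "presheaf_category \<V> ?e" "objectwise_quasi_isomorphisms \<V> ?e"
    by (rule inverted_objectwise_quasi_isomorphisms[OF category_terminal])
  define h where "h = (\<lambda>(X :: (unit, unit, 'a) complex_presheaf, \<eta> :: unit \<Rightarrow> 'a cochain_arrow,
    Y :: (unit, unit, 'a) complex_presheaf). cohomology_map (\<eta> ()) n)"
  have objD: "cochain_complex \<V> (ob X ())" if "X \<in> Obj (presheaf_category \<V> ?e)" for X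
    using that cat_functor.ob[of "opposite ?e" "complex_category \<V>" X "()"]
    by (simp add: presheaf_category_def)
  have arrD: "\<exists>\<eta>. f = (X, \<eta>, Y) \<and> \<eta> () \<in> Homs (complex_category \<V>) (ob X ()) (ob Y ())"
    if "f \<in> Homs (presheaf_category \<V> ?e) X Y" for f X Y
    using that by (auto simp: presheaf_category_def Homs_functor_category)
  show ?thesis
  proof (rule isomorphic_localization_imp_iso[where H = "\<lambda>X. complex_cohomology (ob X ()) n" and h = h])
    show "isomorphic (localization (presheaf_category \<V> ?e) (objectwise_quasi_isomorphisms \<V> ?e)) X Y"
      using assms by (simp add: derived_category_def)
    show "group (complex_cohomology (ob X ()) n)" if "X \<in> Obj (presheaf_category \<V> ?e)" for X
      using complex.group_cohomology objD[OF that] by (simp add: complex_def)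
    show "h f \<in> hom (complex_cohomology (ob X ()) n) (complex_cohomology (ob Y ()) n)"
      if "f \<in> Homs (presheaf_category \<V> ?e) X Y" for X Y f
    proof -
      obtain \<eta> where \<eta>: "f = (X, \<eta>, Y)" "\<eta> () \<in> Homs (complex_category \<V>) (ob X ()) (ob Y ())"
        using arrD[OF \<open>f \<in> Homs (presheaf_category \<V> ?e) X Y\<close>] by blast
      then obtain g where "\<eta> () = (ob X (), g, ob Y ())" "complex_map \<V> (ob X ()) (ob Y ()) g"
        using Homs_complex_category complex_map_iff by metis
      then show ?thesis
        using complex_map.cohomology_map_hom by (simp add: \<eta>(1) h_def)
    qed
    show "h (Ident (presheaf_category \<V> ?e) X) x = x"
      if "X \<in> Obj (presheaf_category \<V> ?e)" "x \<in> carrier (complex_cohomology (ob X ()) n)" for X x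
      using cohomology_map_ident[OF objD[OF that(1)] that(2)]
      by (simp add: presheaf_category_def h_def)
    show "h (Comp (presheaf_category \<V> ?e) g f) x = h g (h f x)"
      if fg: "f \<in> Homs (presheaf_category \<V> ?e) X Y" "g \<in> Homs (presheaf_category \<V> ?e) Y Z"
        and x: "x \<in> carrier (complex_cohomology (ob X ()) n)" for X Y Z f g x
    proof -
      obtain \<eta> \<theta> where "f = (X, \<eta>, Y)" "\<eta> () \<in> Homs (complex_category \<V>) (ob X ()) (ob Y ())"
        "g = (Y, \<theta>, Z)" "\<theta> () \<in> Homs (complex_category \<V>) (ob Y ()) (ob Z ())"
        using arrD[OF fg(1)] arrD[OF fg(2)] by blast
      then show ?thesis
        using cohomology_map_comp[OF _ _ x] by (simp add: presheaf_category_def h_def)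
    qed
    show "h w \<in> iso (complex_cohomology (ob (Dom (presheaf_category \<V> ?e) w) ()) n)
        (complex_cohomology (ob (Cod (presheaf_category \<V> ?e) w) ()) n)"
      if w: "w \<in> objectwise_quasi_isomorphisms \<V> ?e" for w
    proof -
      obtain X \<eta> Y where \<eta>: "w = (X, \<eta>, Y)" "\<eta> () \<in> quasi_isomorphisms \<V>"
        "w \<in> Arr (presheaf_category \<V> ?e)"
        using w by (auto simp: objectwise_quasi_isomorphisms_def)
      then have dc: "Dom (presheaf_category \<V> ?e) w = X" "Cod (presheaf_category \<V> ?e) w = Y"
        by (simp_all add: presheaf_category_def functor_category_def)
      then have "w \<in> Homs (presheaf_category \<V> ?e) X Y"
        using \<eta>(3) by (simp add: Homs_def)
      then have "\<eta> () \<in> Homs (complex_category \<V>) (ob X ()) (ob Y ())"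
        using arrD \<eta>(1) by blast
      then show ?thesis
        using \<eta>(2) by (auto simp: dc) (auto simp: \<eta>(1) h_def quasi_isomorphisms_def Homs_complex_category)
    qed
  qed
qed

lemma (in category_with_terminal) cohomology_with_terminal:
  assumes S: "infinite S" "\<And>T. T \<subseteq> S \<Longrightarrow> T \<in> \<V>"
    and subset: "\<And>A B. A \<in> \<V> \<Longrightarrow> B \<subseteq> A \<Longrightarrow> B \<in> \<V>"
  shows "category_cohomology \<V> A 0 \<cong> integer_group"
    and "n \<noteq> 0 \<Longrightarrow> trivial_group (category_cohomology \<V> A n)"
proof -
  let ?e = "terminal_category" and ?Z = "integers_object \<V>" and ?R = "derived_pushforward \<V> A"
  let ?y = "ob (derived_pullback \<V> A) ?Z"
  have Z: "ob ?Z () = integers_complex \<V>" by (simp add: integers_object_def)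
  interpret complex \<V> "integers_complex \<V>"
    by (rule complex_integers[OF S subset])
  interpret K: category "complex_category \<V>" by (rule category_complex_category)
  have id: "Ident (complex_category \<V>) (integers_complex \<V>) \<in>
      Homs (complex_category \<V>) (integers_complex \<V>) (integers_complex \<V>)"
    by (rule K.ident) (simp add: complex)
  have "cat_functor (opposite ?e) (complex_category \<V>) ?Z"
    using category_opposite[OF category_terminal] K.category_axioms complex id K.ident_left[OF id]
    by (simp add: cat_functor_def cat_functor_axioms_def integers_object_def del: complex_category_simps(2,3))
  then have Z_Obj: "?Z \<in> Obj (derived_category \<V> ?e)"
    by (simp add: derived_category_def localization_def presheaf_category_def)
  \<comment> \<open>Evaluation at the terminal object is the witness that makes the choice of a
    right adjoint legitimate.\<close>
  have R: "right_adjoint (derived_category \<V> ?e) (derived_category \<V> A) (derived_pullback \<V> A) ?R"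
    unfolding derived_pushforward_def by (rule someI_ex) (use derived_pullback_right_adjoint in blast)
  then have L: "cat_functor (derived_category \<V> ?e) (derived_category \<V> A) (derived_pullback \<V> A)"
    and R': "cat_functor (derived_category \<V> A) (derived_category \<V> ?e) ?R"
    by (simp_all add: right_adjoint_def)
  then have y: "?y \<in> Obj (derived_category \<V> A)" and Ry: "ob ?R ?y \<in> Obj (derived_category \<V> ?e)"
    using cat_functor.ob[OF R'] cat_functor.ob[OF L Z_Obj] by simp_all
  \<comment> \<open>Evaluation sends the pullback of \<open>?Z\<close> back to \<open>?Z\<close>
    itself, so uniqueness of adjoints compares \<open>?Z\<close> with the value of the chosen
    adjoint.\<close>
  have "isomorphic (derived_category \<V> ?e) ?Z (ob ?R ?y)"
    using right_adjoint_unique[OF derived_pullback_right_adjoint R y]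
    by (simp add: derived_pullback_def induced_functor_def ob_precomposition comp_def integers_object_def)
  then have iso: "complex_cohomology (integers_complex \<V>) n \<cong> category_cohomology \<V> A n" for n
    unfolding category_cohomology_def using cohomology_iso_derived_terminal Z by metis
  show "category_cohomology \<V> A 0 \<cong> integer_group"
    by (rule iso_trans[OF group.iso_sym[OF group_cohomology iso] cohomology_integers_0[OF S subset]])
  \<comment> \<open>The value of the chosen adjoint is known only as an object of the derived
    category; that already makes it a complex, so its cohomology is a group, as transfer of
    triviality requires.\<close>
  have "cat_functor (opposite ?e) (complex_category \<V>) (ob ?R ?y)"
    using Ry by (simp add: derived_category_def localization_def presheaf_category_def)
  then have "cochain_complex \<V> (ob (ob ?R ?y) ())"
    using cat_functor.ob[of "opposite ?e" "complex_category \<V>" "ob ?R ?y" "()"] by simp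
  then have group: "group (category_cohomology \<V> A n)"
    using complex.group_cohomology by (simp add: category_cohomology_def complex_def)
  show "trivial_group (category_cohomology \<V> A n)" if "n \<noteq> 0"
    by (rule isomorphic_group_triviality1[OF iso group cohomology_integers_nonzero[OF S subset that]])
qed

section \<open>Slices of full subcategories\<close>

context
  fixes C :: "('o, 'a) category" and P and m
  assumes C: "category C" and m: "m \<in> Obj C" "P m"
begin

interpretation category C by (rule C)

abbreviation (input) sl where "sl \<equiv> slice C (full_subcategory C P) m"

lemma Obj_slice: "x \<in> Obj sl \<longleftrightarrow> fst x \<in> Obj C \<and> P (fst x) \<and> snd x \<in> Homs C (fst x) m"
  by (auto simp: slice_def full_subcategory_def)

lemma Homs_slice:
  "h \<in> Homs sl x y \<longleftrightarrow> (\<exists>\<alpha>. h = (x, \<alpha>, y) \<and> x \<in> Obj sl \<and> y \<in> Obj sl \<and>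
     \<alpha> \<in> Homs C (fst x) (fst y) \<and> Comp C (snd y) \<alpha> = snd x)"
  by (cases x; cases y) (auto simp: slice_def full_subcategory_def Homs_def)

lemma Comp_slice: "Comp sl (y', \<beta>, z) (x, \<alpha>, y) = (x, Comp C \<beta> \<alpha>, z)"
  by (simp add: slice_def full_subcategory_def)

lemma Ident_slice: "Ident sl x = (x, Ident C (fst x), x)"
  by (cases x) (simp add: slice_def full_subcategory_def)

lemma category_slice: "category sl"
proof
  fix f assume "f \<in> Arr sl"
  then show "Dom sl f \<in> Obj sl \<and> Cod sl f \<in> Obj sl"
    by (auto simp: slice_def)
next
  fix x assume "x \<in> Obj sl"
  then show "Ident sl x \<in> Homs sl x x"
    using ident ident_right[of "snd x"] by (auto simp: Homs_slice Ident_slice Obj_slice)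
next
  fix x y z f g assume "f \<in> Homs sl x y" "g \<in> Homs sl y z"
  then obtain \<alpha> \<beta> where *: "f = (x, \<alpha>, y)" "g = (y, \<beta>, z)" "x \<in> Obj sl" "z \<in> Obj sl"
      "Comp C (snd y) \<alpha> = snd x" "Comp C (snd z) \<beta> = snd y"
      and \<alpha>: "\<alpha> \<in> Homs C (fst x) (fst y)" and \<beta>: "\<beta> \<in> Homs C (fst y) (fst z)"
    by (auto simp: Homs_slice)
  have "snd z \<in> Homs C (fst z) m" using *(4) by (simp add: Obj_slice)
  from assoc[OF \<alpha> \<beta> this] have "Comp C (snd z) (Comp C \<beta> \<alpha>) = snd x"
    using * by simp
  then show "Comp sl g f \<in> Homs sl x z"
    using * comp[OF \<alpha> \<beta>] by (simp add: Homs_slice Comp_slice)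
next
  fix x y f assume "f \<in> Homs sl x y"
  then obtain \<alpha> where "f = (x, \<alpha>, y)" and \<alpha>: "\<alpha> \<in> Homs C (fst x) (fst y)"
    by (auto simp: Homs_slice)
  then show "Comp sl (Ident sl y) f = f" "Comp sl f (Ident sl x) = f"
    using ident_left[OF \<alpha>] ident_right[OF \<alpha>] by (simp_all add: Comp_slice Ident_slice)
next
  fix x y z w f g h assume "f \<in> Homs sl x y" "g \<in> Homs sl y z" "h \<in> Homs sl z w"
  then obtain \<alpha> \<beta> \<gamma> where "f = (x, \<alpha>, y)" "g = (y, \<beta>, z)" "h = (z, \<gamma>, w)"
      "\<alpha> \<in> Homs C (fst x) (fst y)" "\<beta> \<in> Homs C (fst y) (fst z)" "\<gamma> \<in> Homs C (fst z) (fst w)"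
    by (auto simp: Homs_slice)
  then show "Comp sl h (Comp sl g f) = Comp sl (Comp sl h g) f"
    using assoc by (simp add: Comp_slice)
qed

text \<open>The triangle over \<open>m\<close> forces an arrow from \<open>(i, p)\<close> to
  \<open>(m, Ident C m)\<close> to be \<open>p\<close>, and fullness makes \<open>p\<close> an arrow
  of the subcategory. \<open>P m\<close> is what puts this pair into the slice.\<close>

lemma category_with_terminal_slice:
  "category_with_terminal sl (m, Ident C m) (\<lambda>x. (x, snd x, (m, Ident C m)))"
  unfolding category_with_terminal_def category_with_terminal_axioms_def
proof (intro conjI allI impI)
  show t: "(m, Ident C m) \<in> Obj sl" using m ident by (simp add: Obj_slice)
  fix x
  show "(x, snd x, (m, Ident C m)) \<in> Homs sl x (m, Ident C m)" if "x \<in> Obj sl"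
    using that t ident_left[of "snd x"] by (auto simp: Homs_slice Obj_slice)
  show "f = (x, snd x, (m, Ident C m))" if f: "f \<in> Homs sl x (m, Ident C m)" for f
  proof -
    obtain \<alpha> where "f = (x, \<alpha>, (m, Ident C m))" "\<alpha> \<in> Homs C (fst x) m" "Comp C (Ident C m) \<alpha> = snd x"
      using f by (auto simp: Homs_slice)
    then show ?thesis using ident_left by metis
  qed
qed (rule category_slice)

end

section \<open>Universes\<close>

context
  fixes mem :: "'z \<Rightarrow> 'z \<Rightarrow> bool" and u :: 'z
  assumes u: "universe mem u"
begin

lemma universe_transitive: "mem x u \<Longrightarrow> mem y x \<Longrightarrow> mem y u"
  and universe_pair: "mem x u \<Longrightarrow> mem y u \<Longrightarrow> \<exists>z. mem z u \<and> elts mem z = {x, y}"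
  and universe_power: "mem x u \<Longrightarrow> \<exists>z. mem z u \<and> elts mem z = {y. elts mem y \<subseteq> elts mem x}"
proof -
  have "\<forall>x y. mem x u \<and> mem y x \<longrightarrow> mem y u"
    and "\<forall>x y. mem x u \<and> mem y u \<longrightarrow> (\<exists>z. mem z u \<and> elts mem z = {x, y})"
    and "\<forall>x. mem x u \<longrightarrow> (\<exists>z. mem z u \<and> elts mem z = {y. elts mem y \<subseteq> elts mem x})"
    using u unfolding universe_def by - (elim conjE, assumption)+
  then show "mem x u \<Longrightarrow> mem y x \<Longrightarrow> mem y u"
    and "mem x u \<Longrightarrow> mem y u \<Longrightarrow> \<exists>z. mem z u \<and> elts mem z = {x, y}"
    and "mem x u \<Longrightarrow> \<exists>z. mem z u \<and> elts mem z = {y. elts mem y \<subseteq> elts mem x}"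
    by blast+
qed

lemma universe_Union:
  assumes "mem x u"
  shows "\<exists>z. mem z u \<and> elts mem z = (\<Union>y\<in>elts mem x. elts mem y)"
proof -
  have "\<forall>x f. mem x u \<and> (\<forall>y. mem y x \<longrightarrow> mem (f y) u) \<longrightarrow>
      (\<exists>z. mem z u \<and> elts mem z = (\<Union>y\<in>elts mem x. elts mem (f y)))"
    using u unfolding universe_def by (elim conjE)
  \<comment> \<open>Plain union is the case of the indexed axiom in which the family is the
    identity; transitivity keeps its values in \<open>u\<close>.\<close>
  from this[THEN spec[of _ x], THEN spec[of _ "\<lambda>y. y"]] show ?thesis
    using assms universe_transitive by blast
qed

end

context two_universes
begin

text \<open>Separation yields a set with extension \<open>B\<close> but does not place it in
  \<open>V\<close>; it lies there as an element of a power set that belongs to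
  \<open>V\<close>.\<close>

lemma sets_in_V_subset:
  assumes "A \<in> sets_in mem V" "B \<subseteq> A"
  shows "B \<in> sets_in mem V"
proof -
  obtain x where x: "mem x V" "A = elts mem x"
    using assms(1) by (auto simp: sets_in_def elts_def)
  obtain y where y: "elts mem y = B"
    using separation[of B x] assms(2) x(2) by blast
  obtain z where z: "mem z V" "elts mem z = {y. elts mem y \<subseteq> elts mem x}"
    using universe_power[OF universe_V x(1)] by blast
  have "y \<in> elts mem z" using y assms(2) x(2) by (simp add: z(2))
  then have "mem y z" by (simp add: elts_def)
  then have "mem y V" by (rule universe_transitive[OF universe_V z(1)])
  then have "y \<in> elts mem V" by (simp add: elts_def)
  then show ?thesis using y by (auto simp: sets_in_def)
qed

text \<open>A finite set of naturals would have a maximal element for membership, by foundation, yet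
  each natural belongs to its successor. That successors exist is derived from the axioms of the
  universe \<open>U\<close>.\<close>

lemma infinite_von_neumann_nat: "infinite {x. von_neumann_nat mem x}"
proof
  define S where "S = {x. von_neumann_nat mem x}"
  assume "finite {x. von_neumann_nat mem x}"
  then have fin: "finite S" by (simp add: S_def)
  obtain w where w: "elts mem w = S" "mem w U"
    using omega_in_U by (auto simp: is_omega_def S_def)
  have succ: "\<exists>y\<in>S. mem x y" if x_nat: "x \<in> S" for x
  proof -
    have "mem x w" using x_nat w(1) by (auto simp: elts_def)
    then have x: "mem x U" by (rule universe_transitive[OF universe_U w(2)])
    \<comment> \<open>\<open>s\<close> is the singleton of \<open>x\<close>, and the successor of
      \<open>x\<close> is the union of the pair of \<open>x\<close> and \<open>s\<close>.\<close>
    obtain s where s: "mem s U" "elts mem s = {x, x}"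
      using universe_pair[OF universe_U x x] by blast
    obtain p where p: "mem p U" "elts mem p = {x, s}"
      using universe_pair[OF universe_U x s(1)] by blast
    obtain y where y: "elts mem y = (\<Union>z\<in>elts mem p. elts mem z)"
      using universe_Union[OF universe_U p(1)] by blast
    have "elts mem y = insert x (elts mem x)" unfolding y p(2) by (auto simp: s(2))
    moreover from this have "x \<in> elts mem y" by simp
    then have "mem x y" by (simp add: elts_def)
    ultimately show ?thesis
      using von_neumann_nat.succ[of mem x y] x_nat unfolding S_def by blast
  qed
  obtain e where "elts mem e = {}" using separation[of "{}"] by blast
  then have e: "e \<in> S" by (simp add: S_def von_neumann_nat.zero)
  \<comment> \<open>Membership on the naturals is acyclic; being finite as well, its converse is
    well founded, and a minimal element of the converse is a maximal natural.\<close>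
  define r where "r = {(x, y). mem x y} \<inter> S \<times> S"
  have "acyclic r"
    unfolding r_def by (rule acyclic_subset[OF wf_acyclic[OF foundation]]) blast
  moreover have "finite r" using fin by (simp add: r_def)
  ultimately have "wf (r\<inverse>)" by (intro finite_acyclic_wf_converse)
  then obtain x where x: "x \<in> S" "\<And>y. (y, x) \<in> r\<inverse> \<Longrightarrow> y \<notin> S"
    by (rule wfE_min[OF _ e]) blast
  obtain y where y: "y \<in> S" "mem x y" using succ[OF x(1)] by blast
  with x(1) have "(y, x) \<in> r\<inverse>" by (simp add: r_def)
  then show False using x(2) y(1) by blast
qed

lemma infinite_set_in_V: "\<exists>S\<in>sets_in mem V. infinite S"
proof -
  obtain w where w: "is_omega mem w" "mem w U" using omega_in_U by blast
  then have "mem w V" using universe_transitive[OF universe_V U_in_V] by blast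
  then have "w \<in> elts mem V" by (simp add: elts_def)
  then have "elts mem w \<in> sets_in mem V" by (auto simp: sets_in_def)
  then show ?thesis
    using w(1) infinite_von_neumann_nat by (auto simp: is_omega_def)
qed

end

section \<open>Application to local institutions\<close>

lemma cohomology_models_over:
  assumes "two_universes mem U V" "local_institution mem U V I"
    and S: "S \<in> Obj (Sig I)" and M: "M \<in> Obj (models I S)" and sat: "satisfies I S M \<phi>"
  shows "category_cohomology (sets_in mem V) (models_over I S \<phi> M) 0 \<cong> integer_group"
    and "n \<noteq> 0 \<Longrightarrow> trivial_group (category_cohomology (sets_in mem V) (models_over I S \<phi> M) n)"
proof -
  interpret two_universes mem U V by fact
  interpret local_institution mem U V I by fact
  have "models I S \<in> Obj (category_category mem U)"
    using cat_functor.ob[OF Mdl_functor, of S] S by simp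
  then have "category (models I S)"
    by (simp add: category_category_def universe_category_def)
  then interpret category_with_terminal "models_over I S \<phi> M" "(M, Ident (models I S) M)"
      "\<lambda>x. (x, snd x, (M, Ident (models I S) M))"
    unfolding models_over_def models_of_def using M sat by (rule category_with_terminal_slice)
  obtain T where T: "T \<in> sets_in mem V" "infinite T" using infinite_set_in_V by blast
  show "category_cohomology (sets_in mem V) (models_over I S \<phi> M) 0 \<cong> integer_group"
    by (rule cohomology_with_terminal(1)[OF T(2)]) (use T(1) sets_in_V_subset in blast)+
  show "trivial_group (category_cohomology (sets_in mem V) (models_over I S \<phi> M) n)" if "n \<noteq> 0"
    by (rule cohomology_with_terminal(2)[OF T(2) _ _ that]) (use T(1) sets_in_V_subset in blast)+
qed

theorem proposition4p3:
  fixes mem :: "'z \<Rightarrow> 'z \<Rightarrow> bool" and U V :: 'z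
    and I :: "'z institution" and S M \<phi> :: 'z
  assumes "two_universes mem U V"
    and "local_institution mem U V I"
    and "S \<in> Obj (Sig I)"
    and "M \<in> Obj (models I S)"
    and "\<phi> \<in> formulas I S"
  shows "(satisfies I S M \<phi> \<longrightarrow>
            category_cohomology (sets_in mem V) (models_over I S \<phi> M) 0 \<cong> integer_group \<and>
            (\<forall>n. n \<noteq> 0 \<longrightarrow>
               trivial_group (category_cohomology (sets_in mem V) (models_over I S \<phi> M) n))) \<and>
         (\<forall>\<Gamma>. \<Gamma> \<subseteq> formulas I S \<and>
            (\<exists>\<chi>\<in>\<Gamma>. \<exists>n. n \<noteq> 0 \<and>
               \<not> trivial_group (category_cohomology (sets_in mem V) (models_over I S \<chi> M) n)) \<longrightarrow>
            \<not> (\<forall>\<psi>\<in>\<Gamma>. satisfies I S M \<psi>))"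
  \<comment> \<open>The second conjunct is the contrapositive of the vanishing statement at the
    formula \<open>\<chi>\<close>.\<close>
  using cohomology_models_over[OF assms(1-4)] by blast

end
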